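(* For $p,q\in\mathbb{N}$ with $1\le q<p$ let \[ N(p,q)=\sum_{j\vdash q-1}\ \sum_{k\vdash p-q}\left(\prod_{i=1}^{q-1} j_i!\,i^{j_i}\prod_{i=1}^{p-q}k_i!\,i^{k_i}\right)^{-1}\prod_{a,b=1}^{p-q}\Bigl(1+\sum_{d\mid \operatorname{lcm}(a,b)} d\,j_d\Bigr)^{k_ak_b\gcd(a,b)} \] and \[ L(p,q)=\tfrac12 N(p,q)+\tfrac12\sum_{j\vdash q-1}\ \sum_{k\vdash p-q}\left(\prod_{i=1}^{q-1} j_i!\,i^{j_i}\prod_{i=1}^{p-q}k_i!\,i^{k_i}\right)^{-1}\prod_{a=1}^{p-q}\Bigl(q_a^{k_a}\,p_{a,a}^{k_a^2-k_a}\prod_{b=1}^{a-1}p_{a,b}^{2k_ak_b}\Bigr), \] where, writing $C_t=1+\sum_{d\mid t} d\,j_d$, \[ p_{a,b}=C_{\operatorname{lcm}(2,a,b)}^{\,ab/\operatorname{lcm}(2,a,b)},\qquad q_a=\begin{cases} C_a\,C_{2a}^{(a-1)/2} & a\equiv 1\pmod 2,\\ C_a^{\,a} & a\equiv 0\pmod 4,\\ C_{a/2}^{\,2}\,C_a^{\,a-1} & a\equiv 2\pmod 4.\end{cases} \] Then for every $n\in\mathbb{N}$ the number of nilpotent semigroups of degree $3$ of order $n$ up to isomorphism or anti-isomorphism equals \[ \sum_{m=2}^{a(n)}\bigl(L(n,m)-L(n-1,m-1)\bigr),\qquad a(n)=\left\lfloor n+\tfrac12-\sqrt{n-\tfrac34}\,\right\rfloor.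 \]
   Context: A semigroup $S$ is nilpotent of degree $3$ if $|S^3|=1$ and $|S^2|>1$, where $S^r=\{s_1\cdots s_r : s_i\in S\}$. The dual $S^*$ of $S$ is the set $S$ with multiplication $x\ast y=yx$; a bijection $f:S\to T$ is an anti-isomorphism if it is an isomorphism from $S^*$ to $T$. Two semigroups are identified "up to isomorphism or anti-isomorphism" if there is an isomorphism or an anti-isomorphism between them. $j\vdash n$ means $j$ is a partition of $n$ (empty if $n=0$), $j_i$ is the number of parts of $j$ equal to $i$; sums over $d\mid t$ range over positive divisors of $t$. *)

theory Defs
  imports Complex_Main "HOL-Library.Multiset"
begin

text \<open>A binary operation mm on the carrier {0..<n} (values outside the carrier
are irrelevant) forming a semigroup that is nilpotent of degree 3.\<close>

definition is_semigroup_on :: "nat \<Rightarrow> (nat \<Rightarrow> nat \<Rightarrow> nat) \<Rightarrow> bool" where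
  "is_semigroup_on n mm \<longleftrightarrow>
     (\<forall>x<n. \<forall>y<n. mm x y < n) \<and>
     (\<forall>x<n. \<forall>y<n. \<forall>z<n. mm (mm x y) z = mm x (mm y z))"

definition nilpotent3_on :: "nat \<Rightarrow> (nat \<Rightarrow> nat \<Rightarrow> nat) \<Rightarrow> bool" where
  "nilpotent3_on n mm \<longleftrightarrow>
     is_semigroup_on n mm \<and>
     card {mm (mm x y) z | x y z. x < n \<and> y < n \<and> z < n} = 1 \<and>
     card {mm x y | x y. x < n \<and> y < n} > 1"

definition iso_or_anti :: "nat \<Rightarrow> (nat \<Rightarrow> nat \<Rightarrow> nat) \<Rightarrow> (nat \<Rightarrow> nat \<Rightarrow> nat) \<Rightarrow> bool" where
  "iso_or_anti n m1 m2 \<longleftrightarrow>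
     (\<exists>f. bij_betw f {0..<n} {0..<n} \<and>
        ((\<forall>x<n. \<forall>y<n. f (m1 x y) = m2 (f x) (f y)) \<or>
         (\<forall>x<n. \<forall>y<n. f (m1 x y) = m2 (f y) (f x))))"

definition nil3_semigroups :: "nat \<Rightarrow> (nat \<Rightarrow> nat \<Rightarrow> nat) set" where
  "nil3_semigroups n = {mm. nilpotent3_on n mm}"

definition iso_anti_rel :: "nat \<Rightarrow> ((nat \<Rightarrow> nat \<Rightarrow> nat) \<times> (nat \<Rightarrow> nat \<Rightarrow> nat)) set" where
  "iso_anti_rel n = {(m1, m2). m1 \<in> nil3_semigroups n \<and> m2 \<in> nil3_semigroups n \<and> iso_or_anti n m1 m2}"

definition num_nil3 :: "nat \<Rightarrow> nat" where
  "num_nil3 n = card (nil3_semigroups n // iso_anti_rel n)"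

text \<open>Partitions of n as multisets of positive integers; j_i = count j i.\<close>

definition partitions :: "nat \<Rightarrow> nat multiset set" where
  "partitions n = {M. (\<forall>x\<in>#M. 0 < x) \<and> sum_mset M = n}"

definition Cfun :: "nat multiset \<Rightarrow> nat \<Rightarrow> real" where
  "Cfun j t = 1 + real (\<Sum>d\<in>{d\<in>{1..t}. d dvd t}. d * count j d)"

definition zden :: "nat \<Rightarrow> nat \<Rightarrow> nat multiset \<Rightarrow> nat multiset \<Rightarrow> real" where
  "zden p q j k =
     (\<Prod>i=1..q-1. fact (count j i) * real i ^ count j i) *
     (\<Prod>i=1..p-q. fact (count k i) * real i ^ count k i)"

definition Nfun :: "nat \<Rightarrow> nat \<Rightarrow> real" where
  "Nfun p q = (\<Sum>j\<in>partitions (q-1). \<Sum>k\<in>partitions (p-q).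
      inverse (zden p q j k) *
      (\<Prod>a=1..p-q. \<Prod>b=1..p-q. Cfun j (lcm a b) ^ (count k a * count k b * gcd a b)))"

definition pfun :: "nat multiset \<Rightarrow> nat \<Rightarrow> nat \<Rightarrow> real" where
  "pfun j a b = Cfun j (lcm 2 (lcm a b)) powr (real (a * b) / real (lcm 2 (lcm a b)))"

definition qfun :: "nat multiset \<Rightarrow> nat \<Rightarrow> real" where
  "qfun j a = (if odd a then Cfun j a * Cfun j (2 * a) ^ ((a - 1) div 2)
               else if a mod 4 = 0 then Cfun j a ^ a
               else Cfun j (a div 2) ^ 2 * Cfun j a ^ (a - 1))"

definition Lfun :: "nat \<Rightarrow> nat \<Rightarrow> real" where
  "Lfun p q = Nfun p q / 2 + (1/2) * (\<Sum>j\<in>partitions (q-1). \<Sum>k\<in>partitions (p-q).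
      inverse (zden p q j k) *
      (\<Prod>a=1..p-q. qfun j a ^ count k a * pfun j a a ^ (count k a ^ 2 - count k a) *
          (\<Prod>b=1..a-1. pfun j a b ^ (2 * count k a * count k b))))"

definition a_bound :: "nat \<Rightarrow> int" where
  "a_bound n = \<lfloor>real n + 1/2 - sqrt (real n - 3/4)\<rfloor>"

end

theory Submission
  imports Defs "HOL-Combinatorics.Orbits" "HOL-Combinatorics.Cycles" "HOL-Algebra.Group_Action"
begin

text \<open>
  In a semigroup \<open>S\<close> that is nilpotent of degree 3, a product vanishes as soon as one factor lies in
  \<open>S\<^sup>2\<close>. With \<open>A = S - S\<^sup>2\<close> the multiplication is thus an arbitrary map \<open>A \<times> A \<rightarrow> S\<^sup>2\<close> that
  hits all nonzero elements of \<open>S\<^sup>2\<close>, and (anti-)isomorphism is equivalence under permutations of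
  \<open>A\<close>, permutations of \<open>S\<^sup>2\<close> fixing the zero, and exchange of the arguments. Burnside's lemma counts the
  orbits of all maps \<open>A \<times> A \<rightarrow> S\<^sup>2\<close>: a map fixed by a group element is determined by its values on
  one representative of each cycle of the induced permutation of \<open>A \<times> A\<close>, so the number of fixed
  maps depends only on cycle types. This gives \<open>L(n, m)\<close> with \<open>m = |S\<^sup>2|\<close>; the orbits of maps that
  miss a nonzero value are those of the maps into a set with one element less, which gives the
  subtracted term \<open>L(n - 1, m - 1)\<close>. The bound \<open>a(n)\<close> expresses \<open>m - 1 \<le> (n - m)\<^sup>2\<close>, without which
  no map hits all nonzero values.
\<close>

hide_const (open) Group_Action.orbit

section \<open>Equivariant maps\<close>

text \<open>The orbits on \<open>A \<times> A\<close> are never listed. Every point of an orbit of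
  length l carries an l-th root of the number of values admissible on that orbit, so the product
  over orbits becomes a double product over x and y, which can be sorted by the cycle lengths of x
  and y. The same device accounts for p_{a,b}: its exponent ab / lcm(2,a,b) can be a half-integer (a
  = b = 1), because p_{a,b} is only the share of C \<times> D, for distinct cycles C and D of
  lengths a and b, while under exchange of the arguments each orbit alternates between C \<times> D
  and D \<times> C. In L it occurs with even exponents only. The delicate pairs are those inside one
  cycle: there an odd number of steps can close an orbit, and whether this shortens it depends on a
  modulo 4; hence the three cases of q_a. The factors 1/2 in L come from the group order, which the
  exchange of arguments doubles.\<close>

lemma perm_restrict_permutes:
  assumes "bij_betw f X X"
  shows "perm_restrict f X permutes X"
  using assms by (intro bij_imp_permutes) (auto simp: perm_restrict_def cong: bij_betw_cong)

lemma self_in_orbit_if_bij_betw: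
  assumes "finite X" "bij_betw f X X" "x \<in> X"
  shows "x \<in> orbit f x"
proof -
  have "perm_restrict f X permutes X" by (rule perm_restrict_permutes[OF assms(2)])
  then have "x \<in> orbit (perm_restrict f X) x"
    using assms(1) by (intro permutation_self_in_orbit) (auto simp: permutation_permutes)
  also have "orbit (perm_restrict f X) x = orbit f x"
    by (rule orbit_cong0[OF assms(3)]) (use assms in \<open>auto simp: perm_restrict_def bij_betw_def\<close>)
  finally show ?thesis .
qed

lemma orbit_subset_if_bij_betw:
  assumes "bij_betw f X X" "x \<in> X"
  shows "orbit f x \<subseteq> X"
proof
  fix y assume "y \<in> orbit f x"
  then show "y \<in> X" by induct (use assms in \<open>auto simp: bij_betw_def\<close>)
qed

lemma orbit_eq_if_mem:
  assumes "x \<in> orbit f x" "y \<in> orbit f x"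
  shows "orbit f y = orbit f x"
  using assms by (meson orbit_swap orbit_trans set_eq_subset subsetI)

lemma card_orbit:
  assumes "x \<in> orbit f x"
  shows "card (orbit f x) = funpow_dist1 f x x"
  by (subst orbit_conv_funpow_dist1[OF assms])
     (subst card_image[OF inj_on_funpow_dist1[OF assms]], simp)

lemma card_orbit_pos:
  assumes "x \<in> orbit f x"
  shows "card (orbit f x) > 0"
  using card_orbit[OF assms] by simp

lemma funpow_card_orbit:
  assumes "x \<in> orbit f x"
  shows "(f ^^ card (orbit f x)) x = x"
  using funpow_dist1_prop[OF assms] card_orbit[OF assms] by simp

lemma funpow_eq_self_iff:
  assumes "x \<in> orbit f x"
  shows "(f ^^ n) x = x \<longleftrightarrow> card (orbit f x) dvd n"
proof -
  let ?m = "card (orbit f x)"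
  have *: "(f ^^ n) x = (f ^^ (n mod ?m)) x"
    using funpow_mod_eq[OF funpow_card_orbit[OF assms]] by simp
  show ?thesis
  proof
    assume "(f ^^ n) x = x"
    then have "(f ^^ (n mod ?m)) x = x" using * by simp
    moreover have "n mod ?m < funpow_dist1 f x x"
      using card_orbit[OF assms] by (metis mod_less_divisor zero_less_Suc)
    ultimately have "n mod ?m = 0"
      using funpow_dist1_least by (metis neq0_conv)
    then show "?m dvd n" by auto
  next
    assume "?m dvd n"
    then show "(f ^^ n) x = x" using * by (simp add: mod_eq_0_iff_dvd[THEN iffD2])
  qed
qed

lemma funpow_eq_funpow_iff:
  assumes "x \<in> orbit f x" "i \<le> j"
  shows "(f ^^ i) x = (f ^^ j) x \<longleftrightarrow> card (orbit f x) dvd j - i"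
proof -
  let ?y = "(f ^^ i) x"
  have y: "?y \<in> orbit f x" using assms(1) by (rule funpow_in_orbit)
  have eq: "orbit f ?y = orbit f x" using orbit_eq_if_mem[OF assms(1) y] .
  have "(f ^^ j) x = (f ^^ (j - i)) ?y"
    using assms(2) by (metis add.commute funpow_add le_add_diff_inverse o_apply)
  then show ?thesis using funpow_eq_self_iff[of ?y f "j - i"] eq y by metis
qed

text \<open>Two numbers with the same multiples are equal. Later computations of orbit lengths
  thereby become divisibility statements about the exponents that fix a point.\<close>

lemma card_orbit_eqI:
  assumes "d > 0" "\<And>n. (f ^^ n) x = x \<longleftrightarrow> d dvd n"
  shows "card (orbit f x) = d"
proof -
  have "(f ^^ d) x = x" using assms(2) by simp
  then have "x \<in> orbit f x" using assms(1) by (auto simp: orbit_altdef) metis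
  then have "\<And>n. card (orbit f x) dvd n \<longleftrightarrow> d dvd n"
    using assms(2) funpow_eq_self_iff by metis
  then show ?thesis by (meson dvd_antisym dvd_refl)
qed

lemma bij_betw_orbit:
  assumes "finite X" "bij_betw f X X" "x \<in> X"
  shows "bij_betw f (orbit f x) (orbit f x)"
proof -
  have self: "x \<in> orbit f x" by (rule self_in_orbit_if_bij_betw[OF assms])
  have "inj_on f (orbit f x)"
    using orbit_subset_if_bij_betw[OF assms(2,3)] assms(2) by (meson bij_betw_def inj_on_subset)
  moreover have "f ` orbit f x \<subseteq> orbit f x" by (auto intro: orbit.step)
  ultimately show ?thesis
    using finite_orbit[OF self] by (simp add: bij_betw_def endo_inj_surj)
qed

lemma bij_betw_Diff_orbit:
  assumes "finite X" "bij_betw f X X" "x \<in> X"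
  shows "bij_betw f (X - orbit f x) (X - orbit f x)"
  using bij_betw_DiffI[OF assms(2) bij_betw_orbit[OF assms]] orbit_subset_if_bij_betw[OF assms(2,3)]
  by blast

lemma funpow_equivariant:
  assumes "\<forall>x\<in>X. F (f x) = t (F x)" "f \<in> X \<rightarrow> X" "x \<in> X"
  shows "F ((f ^^ i) x) = (t ^^ i) (F x)"
proof -
  have "(f ^^ i) x \<in> X" for i using assms(2,3) by (induction i) auto
  then show ?thesis by (induction i) (use assms(1) in auto)
qed

text \<open>An equivariant map is determined on an orbit of length \<open>l\<close> by its value at one point,
  which may be any fixed point of the \<open>l\<close>-th power.\<close>

lemma card_equivariant_step:
  fixes f :: "'a \<Rightarrow> 'a" and t :: "'b \<Rightarrow> 'b"
  assumes fin: "finite X" and bij: "bij_betw f X X" and x: "x \<in> X" and t: "t \<in> B \<rightarrow> B"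
  defines "Y \<equiv> X - orbit f x" and "l \<equiv> card (orbit f x)"
  shows "card {F \<in> X \<rightarrow>\<^sub>E B. \<forall>x\<in>X. F (f x) = t (F x)} =
    card {b \<in> B. (t ^^ l) b = b} * card {F \<in> Y \<rightarrow>\<^sub>E B. \<forall>x\<in>Y. F (f x) = t (F x)}"
    (is "card ?EX = card ?S * card ?EY")
proof -
  have self: "x \<in> orbit f x" by (rule self_in_orbit_if_bij_betw[OF fin bij x])
  have fX: "f \<in> X \<rightarrow> X" using bij by (auto simp: bij_betw_def)
  have fY: "f \<in> Y \<rightarrow> Y"
    using bij_betw_Diff_orbit[OF fin bij x] unfolding Y_def by (auto simp: bij_betw_def)
  have OX: "orbit f x \<subseteq> X" by (rule orbit_subset_if_bij_betw[OF bij x])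
  have tB: "(t ^^ i) b \<in> B" if "b \<in> B" for i b using t that by (induction i) auto
  \<comment> \<open>The inverse of \<open>F \<mapsto> (F x, restrict F Y)\<close>: equivariance
    forces the value \<open>(t ^^ i) b\<close> at \<open>(f ^^ i) x\<close>.\<close>
  define ext where "ext = (\<lambda>(b, F). \<lambda>y\<in>X. if y \<in> orbit f x then (t ^^ funpow_dist f x y) b else F y)"
  \<comment> \<open>Well-definedness of \<open>ext\<close>: exponents that reach the same point
    differ by a multiple of \<open>l\<close>, and \<open>t ^^ l\<close> fixes \<open>b\<close>. So
    the particular exponent chosen by \<open>funpow_dist\<close> is immaterial.\<close>
  have tpow: "(t ^^ i) b = (t ^^ j) b" if "b \<in> ?S" "(f ^^ i) x = (f ^^ j) x" for b i j
  proof -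
    have *: "(t ^^ i) b = (t ^^ j) b" if ij: "i \<le> j" "(f ^^ i) x = (f ^^ j) x" and b: "b \<in> ?S" for i j
    proof -
      have "l dvd j - i" using funpow_eq_funpow_iff[OF self ij(1)] ij(2) by (simp add: l_def)
      then obtain c where c: "j = i + l * c" using ij(1) by (metis dvdE le_add_diff_inverse)
      have "(t ^^ (l * c)) b = b"
        using b by (induction c) (auto simp: funpow_add)
      then show ?thesis unfolding c by (simp add: funpow_add)
    qed
    show ?thesis using *[of i j] *[of j i] that by (metis nat_le_linear)
  qed
  have ext_in: "ext (b, F) \<in> ?EX" if b: "b \<in> ?S" and F: "F \<in> ?EY" for b F
  proof -
    have "ext (b, F) (f y) = t (ext (b, F) y)" if y: "y \<in> X" for y
    proof (cases "y \<in> orbit f x")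
      case True
      then have fy: "f y \<in> orbit f x" by (rule orbit.step)
      have "(f ^^ funpow_dist f x (f y)) x = (f ^^ Suc (funpow_dist f x y)) x"
        using funpow_dist_prop[OF fy] funpow_dist_prop[OF True] by simp
      then have "(t ^^ funpow_dist f x (f y)) b = t ((t ^^ funpow_dist f x y) b)"
        using tpow[OF b] by (metis funpow.simps(2) o_apply)
      moreover have "f y \<in> X" using fy OX by auto
      ultimately show ?thesis using True fy y by (simp add: ext_def)
    next
      case False
      then have "y \<in> Y" using y by (simp add: Y_def)
      then have "f y \<in> Y" using fY by auto
      have "f y \<in> X" "f y \<notin> orbit f x" using \<open>f y \<in> Y\<close> by (auto simp: Y_def)
      moreover have "F (f y) = t (F y)" using F \<open>y \<in> Y\<close> by blast
      ultimately show ?thesis using False y by (simp add: ext_def)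
    qed
    moreover have "ext (b, F) \<in> X \<rightarrow>\<^sub>E B"
      using b F tB by (auto simp: ext_def Y_def PiE_def Pi_def)
    ultimately show ?thesis by auto
  qed
  have "bij_betw (\<lambda>F. (F x, restrict F Y)) ?EX (?S \<times> ?EY)"
  proof (rule bij_betw_byWitness[where f' = ext])
    show "\<forall>F\<in>?EX. ext (F x, restrict F Y) = F"
    proof
      fix F assume F: "F \<in> ?EX"
      have orb: "(t ^^ funpow_dist f x y) (F x) = F y" if "y \<in> orbit f x" for y
        using funpow_equivariant[of X F f t x "funpow_dist f x y"] F fX x funpow_dist_prop[OF that]
        by auto
      show "ext (F x, restrict F Y) = F"
      proof
        fix y
        show "ext (F x, restrict F Y) y = F y"
          using F orb[of y] by (cases "y \<in> X") (auto simp: ext_def Y_def PiE_def extensional_def)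
      qed
    qed
    show "\<forall>p\<in>?S \<times> ?EY. (\<lambda>F. (F x, restrict F Y)) (ext p) = p"
    proof
      fix p assume "p \<in> ?S \<times> ?EY"
      then obtain b F where p: "p = (b, F)" "b \<in> ?S" "F \<in> ?EY" by auto
      have "ext (b, F) x = b" using self x by (auto simp: ext_def funpow_dist_0)
      moreover have "restrict (ext (b, F)) Y = F"
      proof
        fix y
        show "restrict (ext (b, F)) Y y = F y"
          using p by (cases "y \<in> Y") (auto simp: ext_def Y_def PiE_def extensional_def)
      qed
      ultimately show "(\<lambda>F. (F x, restrict F Y)) (ext p) = p" using p by simp
    qed
    show "(\<lambda>F. (F x, restrict F Y)) ` ?EX \<subseteq> ?S \<times> ?EY"
    proof (rule image_subsetI)
      fix F assume "F \<in> ?EX"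
      then have F: "F \<in> X \<rightarrow>\<^sub>E B" "\<forall>x\<in>X. F (f x) = t (F x)" by auto
      have "F x \<in> ?S"
        using funpow_equivariant[OF F(2) fX x, of l] funpow_card_orbit[OF self] F(1) x
        by (auto simp: l_def)
      moreover have "restrict F Y (f y) = t (restrict F Y y)" if "y \<in> Y" for y
        using that fY F(2) by (auto simp: Y_def)
      moreover have "restrict F Y \<in> Y \<rightarrow>\<^sub>E B" using F by (auto simp: Y_def)
      ultimately show "(F x, restrict F Y) \<in> ?S \<times> ?EY" by blast
    qed
    show "ext ` (?S \<times> ?EY) \<subseteq> ?EX" using ext_in by blast
  qed
  then show ?thesis by (simp add: bij_betw_same_card card_cartesian_product)
qed

lemma powr_one_over_power:
  fixes c :: real
  assumes "c \<ge> 0" "n > 0"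
  shows "(c powr (1 / real n)) ^ n = c"
proof (cases "c = 0")
  case True
  then show ?thesis using assms(2) by simp
next
  case False
  then have "(c powr (1 / real n)) ^ n = (c powr (1 / real n)) powr real n"
    using assms(1) by (subst powr_realpow) auto
  then show ?thesis using assms by (simp add: powr_powr)
qed

text \<open>The product over orbits \<open>O\<close> of \<open>c (card O)\<close> is written as a product over points, each point
  contributing a \<open>card O\<close>-th root.\<close>

lemma card_equivariant:
  fixes f :: "'a \<Rightarrow> 'a" and t :: "'b \<Rightarrow> 'b"
  assumes "finite X" "bij_betw f X X" "t \<in> B \<rightarrow> B"
  shows "real (card {F \<in> X \<rightarrow>\<^sub>E B. \<forall>x\<in>X. F (f x) = t (F x)}) =
    (\<Prod>x\<in>X. real (card {b \<in> B. (t ^^ card (orbit f x)) b = b}) powr (1 / real (card (orbit f x))))"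
  using assms(1,2)
proof (induction X rule: finite_psubset_induct)
  case (psubset X)
  define c where "c = (\<lambda>l. real (card {b \<in> B. (t ^^ l) b = b}))"
  show ?case
  proof (cases "X = {}")
    case True
    then show ?thesis by simp
  next
    case False
    then obtain x where x: "x \<in> X" by auto
    let ?O = "orbit f x"
    have self: "x \<in> ?O" by (rule self_in_orbit_if_bij_betw[OF psubset.hyps psubset.prems x])
    have OX: "?O \<subseteq> X" by (rule orbit_subset_if_bij_betw[OF psubset.prems x])
    have pos: "card ?O > 0" by (rule card_orbit_pos[OF self])
    have IH: "real (card {F \<in> (X - ?O) \<rightarrow>\<^sub>E B. \<forall>x\<in>X - ?O. F (f x) = t (F x)}) =
        (\<Prod>x\<in>X - ?O. c (card (orbit f x)) powr (1 / real (card (orbit f x))))"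
      unfolding c_def
      by (rule psubset.IH) (use self x bij_betw_Diff_orbit[OF psubset.hyps psubset.prems x] in auto)
    have "(\<Prod>y\<in>?O. c (card (orbit f y)) powr (1 / real (card (orbit f y)))) =
        (\<Prod>y\<in>?O. c (card ?O) powr (1 / real (card ?O)))"
      by (rule prod.cong) (auto simp: orbit_eq_if_mem[OF self])
    also have "\<dots> = c (card ?O)"
      using pos by (simp add: powr_one_over_power c_def)
    finally have "(\<Prod>y\<in>?O. c (card (orbit f y)) powr (1 / real (card (orbit f y)))) = c (card ?O)" .
    then show ?thesis
      unfolding card_equivariant_step[OF psubset.hyps psubset.prems x assms(3)]
      using prod.subset_diff[OF OX psubset.hyps, of "\<lambda>y. c (card (orbit f y)) powr (1 / real (card (orbit f y)))"] IH
      by (simp add: c_def)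
  qed
qed


section \<open>Cycle types\<close>

definition cycle_type :: "('a \<Rightarrow> 'a) \<Rightarrow> 'a set \<Rightarrow> nat multiset" where
  "cycle_type f A = image_mset card (mset_set (orbit f ` A))"

lemma cycle_type_empty [simp]: "cycle_type f {} = {#}"
  by (simp add: cycle_type_def)

lemma cycle_type_cong:
  assumes "f \<in> A \<rightarrow> A" "\<And>x. x \<in> A \<Longrightarrow> f x = g x"
  shows "cycle_type f A = cycle_type g A"
proof -
  have "orbit f ` A = orbit g ` A"
    using orbit_cong0[OF _ assms] by (intro image_cong) auto
  then show ?thesis by (simp add: cycle_type_def)
qed

lemma cycle_type_Diff_orbit:
  assumes "finite A" "bij_betw f A A" "x \<in> A"
  shows "cycle_type f A = add_mset (card (orbit f x)) (cycle_type f (A - orbit f x))"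
proof -
  have self: "y \<in> orbit f y" if "y \<in> A" for y
    by (rule self_in_orbit_if_bij_betw[OF assms(1,2) that])
  have "orbit f ` A = insert (orbit f x) (orbit f ` (A - orbit f x))"
    using assms(3) orbit_eq_if_mem[OF self[OF assms(3)]] by auto
  moreover have "orbit f x \<notin> orbit f ` (A - orbit f x)"
    using self by auto
  ultimately show ?thesis using assms(1) by (simp add: cycle_type_def)
qed

text \<open>Double counting of the points on cycles of length \<open>l\<close>. The product
  \<open>l * count\<close> is also the exponent in which the l-th roots later cancel.\<close>

lemma count_cycle_type:
  assumes "finite A" "bij_betw f A A"
  shows "l * count (cycle_type f A) l = card {x \<in> A. card (orbit f x) = l}"
  using assms
proof (induction A rule: finite_psubset_induct)
  case (psubset A)
  show ?case
  proof (cases "A = {}")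
    case False
    then obtain x where x: "x \<in> A" by auto
    let ?O = "orbit f x"
    have self: "x \<in> ?O" by (rule self_in_orbit_if_bij_betw[OF psubset.hyps psubset.prems x])
    have OA: "?O \<subseteq> A" by (rule orbit_subset_if_bij_betw[OF psubset.prems x])
    have IH: "l * count (cycle_type f (A - ?O)) l = card {x \<in> A - ?O. card (orbit f x) = l}"
      by (rule psubset.IH) (use self x bij_betw_Diff_orbit[OF psubset.hyps psubset.prems x] in auto)
    have "{y \<in> ?O. card (orbit f y) = l} = (if card ?O = l then ?O else {})"
      using orbit_eq_if_mem[OF self] by auto
    moreover have "{y \<in> A. card (orbit f y) = l} =
        {y \<in> ?O. card (orbit f y) = l} \<union> {y \<in> A - ?O. card (orbit f y) = l}"
      using OA by auto
    then have "card {y \<in> A. card (orbit f y) = l} =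
        card {y \<in> ?O. card (orbit f y) = l} + card {y \<in> A - ?O. card (orbit f y) = l}"
      using psubset.hyps finite_subset[OF OA] by (simp add: card_Un_disjoint disjoint_iff)
    ultimately show ?thesis
      using IH cycle_type_Diff_orbit[OF psubset.hyps psubset.prems x] by (auto simp: algebra_simps)
  qed simp
qed

text \<open>Groups the points by cycle length. Since \<open>n\<close> is only an upper bound for
  \<open>card A\<close>, the same index range serves for \<open>A\<close> and for \<open>A\<close>
  with one cycle removed.\<close>

lemma prod_cycle_type:
  fixes g :: "nat \<Rightarrow> 'b :: comm_monoid_mult"
  assumes "finite A" "bij_betw f A A" "card A \<le> n"
  shows "(\<Prod>x\<in>A. g (card (orbit f x))) = (\<Prod>l=1..n. g l ^ (l * count (cycle_type f A) l))"
proof -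
  have "card (orbit f x) \<in> {1..n}" if "x \<in> A" for x
    using card_orbit_pos[OF self_in_orbit_if_bij_betw[OF assms(1,2) that]]
      card_mono[OF assms(1) orbit_subset_if_bij_betw[OF assms(2) that]] assms(3) by simp
  then have "(\<Prod>x\<in>A. g (card (orbit f x))) =
      (\<Prod>l=1..n. \<Prod>x\<in>{x \<in> A. card (orbit f x) = l}. g (card (orbit f x)))"
    using assms(1) by (intro prod.group[symmetric]) auto
  also have "\<dots> = (\<Prod>l=1..n. g l ^ (l * count (cycle_type f A) l))"
    by (rule prod.cong) (auto simp: count_cycle_type[OF assms(1,2)])
  finally show ?thesis .
qed

section \<open>Partitions and their weights\<close>

lemma partitions_0 [simp]: "partitions 0 = {{#}}"
  by (auto simp: partitions_def) (metis multiset_nonemptyE not_gr_zero)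

lemma partitions_memD:
  assumes "k \<in> partitions n" "l \<in># k"
  shows "l \<in> {1..n}" "k - {#l#} \<in> partitions (n - l)"
proof -
  have "sum_mset k = l + sum_mset (k - {#l#})"
    using assms(2) by (metis insert_DiffM sum_mset.add_mset)
  then show "l \<in> {1..n}" "k - {#l#} \<in> partitions (n - l)"
    using assms by (auto simp: partitions_def Suc_le_eq dest: in_diffD)
qed

lemma add_mset_partitions:
  assumes "k \<in> partitions (n - l)" "l \<in> {1..n}"
  shows "add_mset l k \<in> partitions n"
  using assms by (auto simp: partitions_def)

lemma set_mset_partitions: "k \<in> partitions n \<Longrightarrow> set_mset k \<subseteq> {1..n}"
  using partitions_memD(1) by blast

lemma finite_partitions: "finite (partitions n)"
proof (induction n rule: less_induct)
  case (less n)
  have "partitions n \<subseteq> insert {#} (\<Union>l\<in>{1..n}. add_mset l ` partitions (n - l))"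
  proof
    fix k assume k: "k \<in> partitions n"
    show "k \<in> insert {#} (\<Union>l\<in>{1..n}. add_mset l ` partitions (n - l))"
    proof (cases "k = {#}")
      case False
      then obtain l where l: "l \<in># k" by blast
      then have "k = add_mset l (k - {#l#})" by simp
      then show ?thesis using partitions_memD[OF k l] by blast
    qed simp
  qed
  then show ?case by (rule finite_subset) (use less in auto)
qed

text \<open>A permutation commuting with one of cycle type \<open>k\<close> rotates each of the
  \<open>count k i\<close> cycles of length i in one of i ways and permutes these cycles among
  themselves. Absent lengths would contribute the factor 1, so taking the product over the support
  agrees with the intervals in \<open>zden\<close>.\<close>

definition centralizer_size :: "nat multiset \<Rightarrow> real" where
  "centralizer_size k = (\<Prod>i\<in>set_mset k. fact (count k i) * real i ^ count k i)"

lemma centralizer_size_superset: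
  assumes "finite S" "set_mset k \<subseteq> S"
  shows "centralizer_size k = (\<Prod>i\<in>S. fact (count k i) * real i ^ count k i)"
  unfolding centralizer_size_def
  by (rule prod.mono_neutral_left) (use assms in \<open>auto simp: not_in_iff\<close>)

lemma centralizer_size_add_mset:
  "centralizer_size (add_mset l k) = real l * real (Suc (count k l)) * centralizer_size k"
proof -
  let ?S = "set_mset k \<union> {l}"
  have "centralizer_size k =
      fact (count k l) * real l ^ count k l * (\<Prod>i\<in>?S - {l}. fact (count k i) * real i ^ count k i)"
    by (subst centralizer_size_superset[of ?S]) (auto simp: prod.remove[of _ l])
  moreover have "centralizer_size (add_mset l k) = fact (Suc (count k l)) * real l ^ Suc (count k l) *
      (\<Prod>i\<in>?S - {l}. fact (count (add_mset l k) i) * real i ^ count (add_mset l k) i)"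
    by (subst centralizer_size_superset[of ?S]) (auto simp: prod.remove[of _ l])
  moreover have "(\<Prod>i\<in>?S - {l}. fact (count (add_mset l k) i) * real i ^ count (add_mset l k) i) =
      (\<Prod>i\<in>?S - {l}. fact (count k i) * real i ^ count k i)"
    by (rule prod.cong) auto
  ultimately show ?thesis by (simp add: algebra_simps)
qed

lemma sum_mset_eq_sum_count:
  fixes k :: "nat multiset"
  assumes "finite S" "set_mset k \<subseteq> S"
  shows "sum_mset k = (\<Sum>l\<in>S. l * count k l)"
  using assms(2)
proof (induction k)
  case (add x k)
  have "(\<Sum>l\<in>S. l * count (add_mset x k) l) = (\<Sum>l\<in>S. l * count k l + (if l = x then x else 0))"
    by (rule sum.cong) auto
  then show ?case using add assms(1) by (simp add: sum.distrib sum.delta)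
qed simp

lemma sum_count_partitions:
  assumes "k \<in> partitions n"
  shows "(\<Sum>l\<in>set_mset k. l * count k l) = n"
  using assms sum_mset_eq_sum_count[of "set_mset k" k] by (simp add: partitions_def)

text \<open>Marks a part size l in a partition k of n. Removing one such part divides the
  centralizer size by \<open>l * count k l\<close>, so the marked partition has weight
  \<open>l * count k l / centralizer_size k\<close>; summing \<open>l * count k l\<close> over the
  part sizes gives n. Marking a part mirrors singling out the cycle through a given point.\<close>

lemma sum_partitions_remove:
  fixes G :: "nat multiset \<Rightarrow> real"
  shows "(\<Sum>l=1..n. \<Sum>k\<in>partitions (n - l). G (add_mset l k) / centralizer_size k) =
    real n * (\<Sum>k\<in>partitions n. G k / centralizer_size k)"
proof -
  have "(\<Sum>l=1..n. \<Sum>k\<in>partitions (n - l). G (add_mset l k) / centralizer_size k) =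
      (\<Sum>(l, k)\<in>Sigma {1..n} (\<lambda>l. partitions (n - l)). G (add_mset l k) / centralizer_size k)"
    by (rule sum.Sigma) (auto simp: finite_partitions)
  also have "\<dots> = (\<Sum>(k, l)\<in>Sigma (partitions n) set_mset. G k / centralizer_size k * real (l * count k l))"
    by (rule sum.reindex_bij_witness[where i = "\<lambda>(k, l). (l, k - {#l#})" and j = "\<lambda>(l, k). (add_mset l k, l)"])
       (auto simp: partitions_memD add_mset_partitions centralizer_size_add_mset
          simp del: of_nat_Suc dest: partitions_memD(1))
  also have "\<dots> = (\<Sum>k\<in>partitions n. \<Sum>l\<in>set_mset k. G k / centralizer_size k * real (l * count k l))"
    by (rule sum.Sigma[symmetric]) (auto simp: finite_partitions)
  also have "\<dots> = (\<Sum>k\<in>partitions n. G k / centralizer_size k * real n)"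
    by (intro sum.cong refl)
       (simp only: sum_distrib_left[symmetric] of_nat_sum[symmetric] sum_count_partitions)
  finally show ?thesis by (simp add: sum_distrib_left mult.commute)
qed

section \<open>Splitting one cycle off a permutation\<close>

context
  fixes xs :: "'a list" and A :: "'a set" and p :: "'a \<Rightarrow> 'a"
  assumes xs: "distinct xs" "xs \<noteq> []" "set xs \<subseteq> A"
    and p: "p permutes A - set xs"
begin

lemma cycle_of_list_nth:
  assumes "i < length xs"
  shows "cycle_of_list xs (xs ! i) = xs ! (Suc i mod length xs)"
proof -
  have "map (cycle_of_list xs) xs = rotate1 xs"
    using cyclic_rotation[OF xs(1), of 1] by simp
  then show ?thesis using assms nth_rotate1 by (metis nth_map)
qed

lemma cycle_comp_funpow: "((cycle_of_list xs \<circ> p) ^^ i) (hd xs) = xs ! (i mod length xs)"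
proof (induction i)
  case 0
  then show ?case using xs(2) by (simp add: hd_conv_nth)
next
  case (Suc i)
  have i: "i mod length xs < length xs" using xs(2) by simp
  then have "p (xs ! (i mod length xs)) = xs ! (i mod length xs)"
    using p by (intro permutes_not_in) auto
  then show ?case using Suc cycle_of_list_nth[OF i] by (simp add: mod_Suc_eq)
qed

lemma orbit_cycle_comp: "orbit (cycle_of_list xs \<circ> p) (hd xs) = set xs"
proof -
  have "((cycle_of_list xs \<circ> p) ^^ length xs) (hd xs) = hd xs"
    using cycle_comp_funpow[of "length xs"] xs(2) by (simp add: hd_conv_nth)
  then have "orbit (cycle_of_list xs \<circ> p) (hd xs) =
      {((cycle_of_list xs \<circ> p) ^^ m) (hd xs) |m. m < length xs}"
    using xs(2) by (intro orbit_altdef_bounded) auto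
  also have "\<dots> = (\<lambda>m. ((cycle_of_list xs \<circ> p) ^^ m) (hd xs)) ` {..<length xs}"
    by auto
  also have "\<dots> = (!) xs ` {..<length xs}"
    by (rule image_cong) (simp_all add: cycle_comp_funpow)
  finally show ?thesis by (auto simp: in_set_conv_nth)
qed

lemma cycle_comp_outside:
  assumes "y \<in> A - set xs"
  shows "(cycle_of_list xs \<circ> p) y = p y"
  using assms permutes_in_image[OF p, of y] by (auto intro: id_outside_supp)

lemma cycle_comp_permutes: "cycle_of_list xs \<circ> p permutes A"
  by (rule permutes_compose)
     (use permutes_subset[OF p, of A] permutes_subset[OF cycle_permutes xs(3)] in auto)

lemma cycle_comp_perm_restrict: "perm_restrict (cycle_of_list xs \<circ> p) (A - set xs) = p"
  using cycle_comp_outside permutes_not_in[OF p] by (fastforce simp: perm_restrict_def)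

lemma cycle_type_cycle_comp:
  assumes "finite A"
  shows "cycle_type (cycle_of_list xs \<circ> p) A = add_mset (length xs) (cycle_type p (A - set xs))"
proof -
  have "cycle_type (cycle_of_list xs \<circ> p) (A - set xs) = cycle_type p (A - set xs)"
    by (rule sym, rule cycle_type_cong)
       (use cycle_comp_outside permutes_in_image[OF p] in auto)
  moreover have "hd xs \<in> A" using xs by auto
  moreover have "card (set xs) = length xs" using xs(1) by (rule distinct_card)
  ultimately show ?thesis
    using cycle_type_Diff_orbit[OF assms permutes_imp_bij[OF cycle_comp_permutes], of "hd xs"]
    by (simp add: orbit_cycle_comp)
qed

end

text \<open>The converse of the composition studied above. Listing the cycle from \<open>x\<close>
  onwards makes the list unique, whereas a cycle alone determines it only up to rotation.\<close>

lemma permutes_split_cycle: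
  assumes "finite A" "p permutes A" "x \<in> A"
  defines "xs \<equiv> map (\<lambda>i. (p ^^ i) x) [0..<card (orbit p x)]"
  shows "distinct xs" "xs \<noteq> []" "set xs = orbit p x" "hd xs = x"
    and "perm_restrict p (A - set xs) permutes A - set xs"
    and "cycle_of_list xs \<circ> perm_restrict p (A - set xs) = p"
proof -
  have bij: "bij_betw p A A" using assms(2) by (rule permutes_imp_bij)
  have self: "x \<in> orbit p x" by (rule self_in_orbit_if_bij_betw[OF assms(1) bij assms(3)])
  have OA: "orbit p x \<subseteq> A" by (rule orbit_subset_if_bij_betw[OF bij assms(3)])
  let ?l = "card (orbit p x)"
  have l: "?l > 0" by (rule card_orbit_pos[OF self])
  show dist: "distinct xs"
    using inj_on_funpow_dist1[OF self] unfolding card_orbit[OF self, symmetric]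
    by (simp add: xs_def distinct_map)
  show ne: "xs \<noteq> []" using l by (auto simp: xs_def)
  show set: "set xs = orbit p x"
    using orbit_conv_funpow_dist1[OF self] unfolding card_orbit[OF self, symmetric]
    by (simp add: xs_def)
  show "hd xs = x" using l by (simp add: xs_def hd_map)
  show perm: "perm_restrict p (A - set xs) permutes A - set xs"
    unfolding set by (rule perm_restrict_diff_cyclic[OF assms(2) cyclic_on_orbit[OF assms(2,1)]])
  show "cycle_of_list xs \<circ> perm_restrict p (A - set xs) = p"
  proof
    fix y
    have len: "length xs = ?l" by (simp add: xs_def)
    consider "y \<in> set xs" | "y \<in> A - set xs" | "y \<notin> A" using OA set by auto
    then show "(cycle_of_list xs \<circ> perm_restrict p (A - set xs)) y = p y"
    proof cases
      case 1
      then obtain i where i: "i < ?l" "y = xs ! i" by (auto simp: in_set_conv_nth len)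
      have "cycle_of_list xs y = xs ! (Suc i mod ?l)"
        using cycle_of_list_nth[OF dist ne, of UNIV id i] i len by (simp add: permutes_id)
      also have "\<dots> = (p ^^ (Suc i mod ?l)) x" using l by (simp add: xs_def)
      also have "\<dots> = (p ^^ Suc i) x" by (rule funpow_mod_eq[OF funpow_card_orbit[OF self]])
      also have "\<dots> = p y" using i by (simp add: xs_def)
      finally show ?thesis using 1 by (simp add: perm_restrict_def)
    next
      case 2
      then have "p y \<in> A - set xs" using permutes_in_image[OF perm, of y] by (simp add: perm_restrict_def)
      then show ?thesis using 2 by (simp add: perm_restrict_def id_outside_supp)
    next
      case 3
      then show ?thesis
        using OA set permutes_not_in[OF assms(2)] by (auto simp: perm_restrict_def id_outside_supp)
    qed
  qed
qed

text \<open>A permutation amounts to its cycle through \<open>x\<close>, written as a list with head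
  \<open>x\<close>, and a permutation of the remaining points. The cycle type then decomposes
  accordingly, so any sum over cycle types can be computed recursively.\<close>

lemma sum_permutes_split_cycle:
  fixes G :: "nat multiset \<Rightarrow> real"
  assumes "finite A" "x \<in> A"
  defines "D \<equiv> {xs. distinct xs \<and> xs \<noteq> [] \<and> set xs \<subseteq> A \<and> hd xs = x}"
  shows "(\<Sum>p | p permutes A. G (cycle_type p A)) =
    (\<Sum>xs\<in>D. \<Sum>p | p permutes A - set xs. G (add_mset (length xs) (cycle_type p (A - set xs))))"
proof -
  have fin: "finite D"
    by (rule finite_subset[OF _ finite_subset_distinct[OF assms(1)]]) (auto simp: D_def)
  have "(\<Sum>p | p permutes A. G (cycle_type p A)) =
      (\<Sum>(xs, p)\<in>Sigma D (\<lambda>xs. {p. p permutes A - set xs}).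
        G (add_mset (length xs) (cycle_type p (A - set xs))))"
  proof (rule sum.reindex_bij_witness[where i = "\<lambda>(xs, p). cycle_of_list xs \<circ> p" and
        j = "\<lambda>p. (map (\<lambda>i. (p ^^ i) x) [0..<card (orbit p x)], perm_restrict p (A - orbit p x))"])
    fix p assume "p \<in> {p. p permutes A}"
    then have p: "p permutes A" by simp
    note split = permutes_split_cycle[OF assms(1) p assms(2)]
    let ?j = "(map (\<lambda>i. (p ^^ i) x) [0..<card (orbit p x)], perm_restrict p (A - orbit p x))"
    show i: "(case ?j of (xs, p) \<Rightarrow> cycle_of_list xs \<circ> p) = p"
      using split(3,6) by simp
    have "orbit p x \<subseteq> A" by (rule permutes_orbit_subset[OF p assms(2)])
    then show "?j \<in> Sigma D (\<lambda>xs. {p. p permutes A - set xs})"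
      using split(1-5) unfolding D_def by simp
    show "(case ?j of (xs, p) \<Rightarrow> G (add_mset (length xs) (cycle_type p (A - set xs)))) = G (cycle_type p A)"
      using cycle_type_cycle_comp[OF split(1,2) _ split(5) assms(1)] split(3,6) \<open>orbit p x \<subseteq> A\<close> by simp
  next
    fix q assume "q \<in> Sigma D (\<lambda>xs. {p. p permutes A - set xs})"
    then obtain xs p where q: "q = (xs, p)" "distinct xs" "xs \<noteq> []" "set xs \<subseteq> A" "hd xs = x"
      "p permutes A - set xs" by (auto simp: D_def)
    let ?p = "cycle_of_list xs \<circ> p"
    have orb: "orbit ?p x = set xs" using orbit_cycle_comp[OF q(2,3,4,6)] q(5) by simp
    have "map (\<lambda>i. (?p ^^ i) x) [0..<card (orbit ?p x)] = xs"
      using cycle_comp_funpow[OF q(2,3,4,6)] q(5) distinct_card[OF q(2)] orb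
      by (intro nth_equalityI) auto
    moreover have "perm_restrict ?p (A - orbit ?p x) = p"
      using cycle_comp_perm_restrict[OF q(2,3,4,6)] orb by simp
    ultimately show "(\<lambda>p. (map (\<lambda>i. (p ^^ i) x) [0..<card (orbit p x)], perm_restrict p (A - orbit p x)))
        (case q of (xs, p) \<Rightarrow> cycle_of_list xs \<circ> p) = q"
      using q(1) by simp
    show "(case q of (xs, p) \<Rightarrow> cycle_of_list xs \<circ> p) \<in> {p. p permutes A}"
      using cycle_comp_permutes[OF q(2,3,4,6)] q(1) by simp
  qed
  also have "\<dots> = (\<Sum>xs\<in>D. \<Sum>p | p permutes A - set xs. G (add_mset (length xs) (cycle_type p (A - set xs))))"
    by (rule sum.Sigma[symmetric]) (use fin assms(1) in \<open>auto simp: finite_permutations\<close>)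
  finally show ?thesis .
qed

text \<open>With the head prescribed, the tail is an injective choice of \<open>l - 1\<close> among
  the other \<open>card A - 1\<close> points. The falling factorial is written as a quotient so that
  its denominator can cancel against the number of permutations of the points left over.\<close>

lemma card_distinct_lists_hd:
  assumes "finite A" "x \<in> A" "l \<in> {1..card A}"
  shows "real (card {xs. distinct xs \<and> xs \<noteq> [] \<and> set xs \<subseteq> A \<and> hd xs = x \<and> length xs = l}) =
    fact (card A - 1) / fact (card A - l)"
proof -
  let ?T = "{ys. length ys = l - 1 \<and> distinct ys \<and> set ys \<subseteq> A - {x}}"
  have "{xs. distinct xs \<and> xs \<noteq> [] \<and> set xs \<subseteq> A \<and> hd xs = x \<and> length xs = l} = (#) x ` ?T"
  proof (intro Set.set_eqI iffI)
    fix xs assume "xs \<in> {xs. distinct xs \<and> xs \<noteq> [] \<and> set xs \<subseteq> A \<and> hd xs = x \<and> length xs = l}"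
    then show "xs \<in> (#) x ` ?T" by (cases xs) auto
  next
    fix xs assume "xs \<in> (#) x ` ?T"
    then show "xs \<in> {xs. distinct xs \<and> xs \<noteq> [] \<and> set xs \<subseteq> A \<and> hd xs = x \<and> length xs = l}"
      using assms by auto
  qed
  then have "card {xs. distinct xs \<and> xs \<noteq> [] \<and> set xs \<subseteq> A \<and> hd xs = x \<and> length xs = l} = card ?T"
    by (simp add: card_image)
  also have "\<dots> = \<Prod>{card A - 1 - (l - 1) + 1..card A - 1}"
    using assms by (subst card_lists_distinct_length_eq) auto
  also have "\<dots> = fact (card A - 1) div fact (card A - l)"
    using assms fact_div_fact[of "card A - l" "card A - 1"] by (auto simp: Suc_diff_le)
  finally show ?thesis
    using assms(3) by (simp only: real_of_nat_div[OF fact_dvd] of_nat_fact diff_le_mono2 atLeastAtMost_iff)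
qed

text \<open>A permutation of cycle type \<open>k\<close> has a centralizer of order \<open>centralizer_size k\<close>. The proof
  splits off the cycle through a chosen point \<open>x\<close>.\<close>

lemma sum_permutes_cycle_type:
  fixes G :: "nat multiset \<Rightarrow> real"
  assumes "finite A"
  shows "(\<Sum>p | p permutes A. G (cycle_type p A)) =
    fact (card A) * (\<Sum>k\<in>partitions (card A). G k / centralizer_size k)"
  using assms
proof (induction A arbitrary: G rule: finite_psubset_induct)
  case (psubset A)
  show ?case
  proof (cases "A = {}")
    case True
    then show ?thesis by (simp add: centralizer_size_def)
  next
    case False
    then obtain x where x: "x \<in> A" by auto
    let ?n = "card A"
    have n: "?n > 0" using x psubset.hyps by (simp add: card_gt_0_iff) blast
    define D where "D = {xs. distinct xs \<and> xs \<noteq> [] \<and> set xs \<subseteq> A \<and> hd xs = x}"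
    define H where "H = (\<lambda>l. fact (?n - l) * (\<Sum>k\<in>partitions (?n - l). G (add_mset l k) / centralizer_size k))"
    have fin: "finite D"
      by (rule finite_subset[OF _ finite_subset_distinct[OF psubset.hyps]]) (auto simp: D_def)
    have "(\<Sum>p | p permutes A - set xs. G (add_mset (length xs) (cycle_type p (A - set xs)))) = H (length xs)"
      if "xs \<in> D" for xs
    proof -
      have "x \<in> set xs" using that by (auto simp: D_def)
      then have "A - set xs \<subset> A" using x by blast
      moreover have "card (A - set xs) = ?n - length xs"
        using that by (simp add: D_def card_Diff_subset distinct_card)
      ultimately show ?thesis
        using psubset.IH[of "A - set xs" "\<lambda>k. G (add_mset (length xs) k)"] by (simp add: H_def)
    qed
    then have "(\<Sum>p | p permutes A. G (cycle_type p A)) = (\<Sum>xs\<in>D. H (length xs))"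
      using sum_permutes_split_cycle[OF psubset.hyps x, of G] by (simp add: D_def)
    also have "\<dots> = (\<Sum>l=1..?n. \<Sum>xs\<in>{xs \<in> D. length xs = l}. H (length xs))"
    proof (rule sum.group[symmetric])
      show "length ` D \<subseteq> {1..?n}"
        using psubset.hyps by (auto simp: D_def Suc_le_eq card_mono card_gt_0_iff simp flip: distinct_card)
    qed (use fin in auto)
    also have "\<dots> = (\<Sum>l=1..?n. real (card {xs \<in> D. length xs = l}) * H l)"
      by (rule sum.cong) auto
    \<comment> \<open>The factor \<open>fact (?n - l)\<close> of \<open>H l\<close> cancels the
      denominator in the number of lists; what is left is the sum over partitions with a marked
      part.\<close>
    also have "\<dots> = (\<Sum>l=1..?n. fact (?n - 1) * (\<Sum>k\<in>partitions (?n - l). G (add_mset l k) / centralizer_size k))"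
      using card_distinct_lists_hd[OF psubset.hyps x]
      by (intro sum.cong) (auto simp: D_def H_def conj_assoc)
    also have "\<dots> = fact (?n - 1) * (real ?n * (\<Sum>k\<in>partitions ?n. G k / centralizer_size k))"
      unfolding sum_partitions_remove[symmetric] by (rule sum_distrib_left[symmetric])
    also have "\<dots> = fact ?n * (\<Sum>k\<in>partitions ?n. G k / centralizer_size k)"
      using n by (simp add: fact_reduce[of ?n])
    finally show ?thesis .
  qed
qed


section \<open>Maps commuting with a pair of permutations\<close>

lemma Cfun_pos: "Cfun j t > 0"
  unfolding Cfun_def by (intro add_pos_nonneg of_nat_0_le_iff) simp

text \<open>A point is fixed by \<open>t ^^ l\<close> iff the length d of its cycle divides l, and
  the cycles of length d have \<open>d * count j d\<close> points. The summand 1 in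
  \<open>Cfun\<close> is the zero, which lies outside \<open>{1..<m}\<close> and is therefore
  fixed.\<close>

lemma Cfun_cycle_type:
  fixes m :: nat
  assumes "t permutes {1..<m}" "m > 0" "l > 0"
  shows "real (card {b \<in> {..<m}. (t ^^ l) b = b}) = Cfun (cycle_type t {1..<m}) l"
proof -
  let ?B = "{1..<m}" and ?T = "{d \<in> {1..l}. d dvd l}"
  have bij: "bij_betw t ?B ?B" using assms(1) by (rule permutes_imp_bij)
  have self: "b \<in> orbit t b" if "b \<in> ?B" for b
    by (rule self_in_orbit_if_bij_betw[OF _ bij that]) simp
  let ?S = "{b \<in> ?B. card (orbit t b) dvd l}"
  have "t 0 = 0" using assms(1) by (rule permutes_not_in) simp
  then have "(t ^^ l) 0 = 0" by (induction l) auto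
  moreover have "{..<m} = insert 0 ?B" using assms(2) by auto
  ultimately have "{b \<in> {..<m}. (t ^^ l) b = b} = insert 0 ?S"
    using funpow_eq_self_iff[OF self] by auto
  then have "card {b \<in> {..<m}. (t ^^ l) b = b} = Suc (card ?S)" by simp
  also have "card ?S = (\<Sum>b\<in>?S. 1)" by simp
  also have "\<dots> = (\<Sum>d\<in>?T. \<Sum>b\<in>{b \<in> ?S. card (orbit t b) = d}. 1)"
    using assms(3) by (intro sum.group[symmetric])
      (auto simp: dvd_imp_le Suc_le_eq intro: card_orbit_pos self)
  also have "\<dots> = (\<Sum>d\<in>?T. d * count (cycle_type t ?B) d)"
  proof (rule sum.cong)
    fix d assume "d \<in> ?T"
    then have "{b \<in> ?S. card (orbit t b) = d} = {b \<in> ?B. card (orbit t b) = d}" by auto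
    then show "(\<Sum>b\<in>{b \<in> ?S. card (orbit t b) = d}. 1) = d * count (cycle_type t ?B) d"
      using count_cycle_type[OF _ bij, of d] by simp
  qed simp
  finally show ?thesis by (simp add: Cfun_def)
qed

text \<open>The share of a single point on an orbit of length \<open>l\<close>; the \<open>l\<close>
  points together contribute the full number \<open>Cfun j l\<close> of choices.\<close>

definition Croot :: "nat multiset \<Rightarrow> nat \<Rightarrow> real" where
  "Croot j l = Cfun j l powr (1 / real l)"

lemma Croot_power: "l > 0 \<Longrightarrow> Croot j l ^ (l * k) = Cfun j l ^ k"
  using Cfun_pos[of j l] by (simp add: Croot_def power_mult powr_one_over_power)

definition pair_map :: "bool \<Rightarrow> ('a \<Rightarrow> 'a) \<Rightarrow> 'a \<times> 'a \<Rightarrow> 'a \<times> 'a" where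
  "pair_map s f = (\<lambda>(x, y). if s then (f y, f x) else (f x, f y))"

text \<open>Exchanging coordinates commutes with applying \<open>f\<close> to both and is an
  involution, so only the parity of \<open>n\<close> matters.\<close>

lemma pair_map_funpow:
  "(pair_map s f ^^ n) (x, y) =
    (if s \<and> odd n then ((f ^^ n) y, (f ^^ n) x) else ((f ^^ n) x, (f ^^ n) y))"
  by (induction n) (auto simp: pair_map_def)

lemma bij_betw_pair_map:
  assumes "bij_betw f A A"
  shows "bij_betw (pair_map s f) (A \<times> A) (A \<times> A)"
proof -
  have "bij_betw (map_prod f f) (A \<times> A) (A \<times> A)"
    by (rule bij_betw_map_prod[OF assms assms])
  moreover have "bij_betw prod.swap (A \<times> A) (A \<times> A)"
    by (auto simp: bij_betw_def)
  ultimately have "bij_betw (if s then prod.swap \<circ> map_prod f f else map_prod f f) (A \<times> A) (A \<times> A)"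
    by (auto intro: bij_betw_trans)
  moreover have "pair_map s f = (if s then prod.swap \<circ> map_prod f f else map_prod f f)"
    by (auto simp: pair_map_def fun_eq_iff)
  ultimately show ?thesis by simp
qed

lemma card_equivariant_pair_map:
  fixes m :: nat
  assumes "finite A" "p permutes A" "t permutes {1..<m}" "m > 0"
  shows "real (card {F \<in> A \<times> A \<rightarrow>\<^sub>E {..<m}. \<forall>z\<in>A \<times> A. F (pair_map s p z) = t (F z)}) =
    (\<Prod>x\<in>A. \<Prod>y\<in>A. Croot (cycle_type t {1..<m}) (card (orbit (pair_map s p) (x, y))))"
proof -
  let ?f = "pair_map s p" and ?X = "A \<times> A"
  have bij: "bij_betw ?f ?X ?X" by (rule bij_betw_pair_map[OF permutes_imp_bij[OF assms(2)]])
  have fin: "finite ?X" using assms(1) by simp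
  have "t permutes {..<m}" by (rule permutes_subset[OF assms(3)]) auto
  then have t: "t \<in> {..<m} \<rightarrow> {..<m}" using permutes_in_image by fastforce
  have pos: "card (orbit ?f z) > 0" if "z \<in> ?X" for z
    by (rule card_orbit_pos[OF self_in_orbit_if_bij_betw[OF fin bij that]])
  show ?thesis
    unfolding card_equivariant[OF fin bij t] prod.cartesian_product
    by (rule prod.cong) (use Cfun_cycle_type[OF assms(3,4) pos] in \<open>auto simp: Croot_def\<close>)
qed

section \<open>Fixed tables without exchange of the arguments\<close>

lemma card_orbit_pair_map_False:
  assumes "x \<in> orbit p x" "y \<in> orbit p y"
  shows "card (orbit (pair_map False p) (x, y)) = lcm (card (orbit p x)) (card (orbit p y))"
proof (rule card_orbit_eqI)
  show "0 < lcm (card (orbit p x)) (card (orbit p y))"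
    using assms card_orbit_pos by (metis lcm_pos_nat)
qed (auto simp: pair_map_funpow funpow_eq_self_iff assms)

text \<open>For cycles of lengths a and b, all ab pairs lie on orbits of length
  \<open>lcm a b\<close>, which makes \<open>gcd a b\<close> orbits; there are
  \<open>count k a * count k b\<close> such ordered pairs of cycles.\<close>

lemma card_fixed_untwisted:
  fixes m :: nat
  assumes A: "finite A" "card A = n" "p permutes A" and t: "t permutes {1..<m}" "m > 0"
  defines "j \<equiv> cycle_type t {1..<m}" and "k \<equiv> cycle_type p A"
  shows "real (card {F \<in> A \<times> A \<rightarrow>\<^sub>E {..<m}. \<forall>z\<in>A \<times> A. F (pair_map False p z) = t (F z)}) =
    (\<Prod>a=1..n. \<Prod>b=1..n. Cfun j (lcm a b) ^ (count k a * count k b * gcd a b))"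
proof -
  have bij: "bij_betw p A A" by (rule permutes_imp_bij[OF A(3)])
  note self = self_in_orbit_if_bij_betw[OF A(1) bij]
  note to_type = prod_cycle_type[OF A(1) bij, of n, unfolded k_def[symmetric]]
  have "(\<Prod>x\<in>A. \<Prod>y\<in>A. Croot j (card (orbit (pair_map False p) (x, y)))) =
      (\<Prod>x\<in>A. \<Prod>y\<in>A. Croot j (lcm (card (orbit p x)) (card (orbit p y))))"
    by (intro prod.cong refl) (simp add: card_orbit_pair_map_False self)
  also have "\<dots> = (\<Prod>a=1..n. (\<Prod>b=1..n. Croot j (lcm a b) ^ (b * count k b)) ^ (a * count k a))"
    using A(2) to_type[of "\<lambda>b. Croot j (lcm (card (orbit p _)) b)"]
      to_type[of "\<lambda>a. \<Prod>b=1..n. Croot j (lcm a b) ^ (b * count k b)"] by simp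
  also have "\<dots> = (\<Prod>a=1..n. \<Prod>b=1..n. Cfun j (lcm a b) ^ (count k a * count k b * gcd a b))"
  proof (intro prod.cong refl)
    fix a assume a: "a \<in> {1..n}"
    have "(Croot j (lcm a b) ^ (b * count k b)) ^ (a * count k a) =
        Cfun j (lcm a b) ^ (count k a * count k b * gcd a b)" if b: "b \<in> {1..n}" for b
    proof -
      have "b * count k b * (a * count k a) = (a * b) * (count k a * count k b)"
        by (simp add: algebra_simps)
      also have "a * b = lcm a b * gcd a b" by (metis prod_gcd_lcm_nat mult.commute)
      finally have "b * count k b * (a * count k a) = lcm a b * (count k a * count k b * gcd a b)"
        by (simp add: algebra_simps)
      moreover have "lcm a b > 0" using a b by (simp add: lcm_pos_nat)
      ultimately show ?thesis by (metis power_mult Croot_power)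
    qed
    then show "(\<Prod>b=1..n. Croot j (lcm a b) ^ (b * count k b)) ^ (a * count k a) =
        (\<Prod>b=1..n. Cfun j (lcm a b) ^ (count k a * count k b * gcd a b))"
      by (simp add: prod_power_distrib)
  qed
  finally show ?thesis
    using card_equivariant_pair_map[OF A(1,3) t, of False] by (simp add: j_def)
qed

section \<open>Fixed tables with exchange of the arguments\<close>

text \<open>An odd power could fix \<open>(x, y)\<close> only by carrying \<open>y\<close> to
  \<open>x\<close>, which is impossible on different cycles. So the exponent must be even, whence
  the 2 in the lcm.\<close>

lemma card_orbit_pair_map_True:
  assumes "x \<in> orbit p x" "y \<in> orbit p y" "y \<notin> orbit p x"
  shows "card (orbit (pair_map True p) (x, y)) = lcm 2 (lcm (card (orbit p x)) (card (orbit p y)))"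
proof (rule card_orbit_eqI)
  show "0 < lcm 2 (lcm (card (orbit p x)) (card (orbit p y)))"
    using assms card_orbit_pos by (metis lcm_pos_nat zero_less_numeral)
  fix n
  have "(p ^^ n) y \<noteq> x"
  proof
    assume "(p ^^ n) y = x"
    then have "x \<in> orbit p y" using funpow_in_orbit[OF assms(2), of n] by simp
    then show False using orbit_swap[OF assms(2)] assms(3) by blast
  qed
  then show "(pair_map True p ^^ n) (x, y) = (x, y) \<longleftrightarrow>
      lcm 2 (lcm (card (orbit p x)) (card (orbit p y))) dvd n"
    by (auto simp: pair_map_funpow funpow_eq_self_iff assms(1,2))
qed

text \<open>The length of the orbit of \<open>(x, p\<^sup>d x)\<close> under \<open>(x, y) \<mapsto> (p y, p x)\<close>, where \<open>x\<close> lies on a cycle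
  of \<open>p\<close> of length \<open>a\<close> and \<open>d < a\<close>.\<close>

definition diag_length :: "nat \<Rightarrow> nat \<Rightarrow> nat" where
  "diag_length a d =
    (if d = 0 then a else if odd a then 2 * a
     else if 2 * d = a \<and> a mod 4 = 2 then a div 2 else a)"

text \<open>The right-hand side is the condition that \<open>n\<close> steps fix the pair (x, p^d
  x). For odd n it demands both n = -d and n = d modulo a, hence a | 2d, which leaves d = 0 or 2d =
  a. In the second case a is even, so n has the parity of d, and an odd n exists only if d is odd,
  that is, a = 2 modulo 4; the orbit then closes already after a/2 steps. For odd a and d > 0 no odd
  n qualifies, and the length is 2a.\<close>

lemma diag_length_dvd_iff:
  assumes "0 < a" "d < a"
  shows "diag_length a d dvd n \<longleftrightarrow>
    (if even n then a dvd n else a dvd n + d \<and> n mod a = d)"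
proof (cases "d = 0")
  case True
  then show ?thesis by (auto simp: diag_length_def)
next
  case False
  have half: "2 * d = a" if "a dvd n + d" "n mod a = d" "even a"
  proof -
    have "n + d = a * (n div a) + 2 * d" using that(2) by (metis mult_div_mod_eq add.assoc mult_2)
    then have "a dvd 2 * d" using that(1) by (metis dvd_add_right_iff dvd_triv_left)
    then obtain c where c: "2 * d = a * c" by auto
    have "a * c < a * 2" using c assms by linarith
    then have "c < 2" using assms by (simp only: mult_less_cancel1)
    moreover have "0 < c" using c False by (auto intro!: gr0I)
    ultimately show ?thesis using c by (simp add: less_2_cases_iff)
  qed
  show ?thesis
  proof (cases "odd a")
    case True
    have "\<not> (a dvd n + d \<and> n mod a = d)"
    proof
      assume h: "a dvd n + d \<and> n mod a = d"
      have "n + d = a * (n div a) + 2 * d" using h by (metis mult_div_mod_eq add.assoc mult_2)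
      then have "a dvd 2 * d" using h by (metis dvd_add_right_iff dvd_triv_left)
      then have "a dvd d" using True by (simp add: coprime_dvd_mult_right_iff)
      then show False using False assms by (auto dest: dvd_imp_le)
    qed
    moreover have "2 * a dvd n \<longleftrightarrow> even n \<and> a dvd n"
      using True by (auto intro: divides_mult dvd_mult_left dvd_mult_right)
    ultimately show ?thesis using True False by (auto simp: diag_length_def)
  next
    case even: False
    show ?thesis
    proof (cases "2 * d = a \<and> a mod 4 = 2")
      case True
      then have d: "odd d" and a: "a = 2 * d" by presburger+
      have "d dvd n \<longleftrightarrow> (if even n then a dvd n else a dvd n + d \<and> n mod a = d)"
      proof
        assume "d dvd n"
        then obtain c where c: "n = d * c" by auto
        show "if even n then a dvd n else a dvd n + d \<and> n mod a = d"
        proof (cases "even n")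
          case True
          then obtain e where "c = 2 * e" using c d by auto
          then show ?thesis using True c a by simp
        next
          case odd: False
          then obtain e where "c = 2 * e + 1" using c by (auto elim!: oddE)
          then have n: "n = a * e + d" using c a by (simp add: algebra_simps)
          then have "n + d = a * (e + 1)" using a by simp
          then have "a dvd n + d" by simp
          then show ?thesis using n odd assms by simp
        qed
      next
        assume h: "if even n then a dvd n else a dvd n + d \<and> n mod a = d"
        show "d dvd n"
        proof (cases "even n")
          case True
          then show ?thesis using h a by (auto dest: dvd_mult_right)
        next
          case False
          then have "d dvd n + d" using h a by (auto dest: dvd_mult_right)
          then show ?thesis by (simp add: dvd_add_left_iff)
        qed
      qed
      moreover have "a div 2 = d" using a by simp
      ultimately show ?thesis using True False even by (simp add: diag_length_def)
    next
      case no: False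
      have "\<not> (a dvd n + d \<and> n mod a = d)" if "odd n"
      proof
        assume h: "a dvd n + d \<and> n mod a = d"
        then have "2 * d = a" using half even by blast
        then have "even d" using no even by presburger
        moreover have "n = a * (n div a) + d" using h by (metis mult_div_mod_eq)
        ultimately show False using that even by (metis dvd_add dvd_mult2)
      qed
      moreover have "a dvd n \<Longrightarrow> even n" using even by (meson dvd_trans)
      ultimately show ?thesis using False even no by (auto simp: diag_length_def)
    qed
  qed
qed

lemma card_orbit_pair_map_diag:
  assumes "x \<in> orbit p x" "d < card (orbit p x)"
  shows "card (orbit (pair_map True p) (x, (p ^^ d) x)) = diag_length (card (orbit p x)) d"
proof (rule card_orbit_eqI)
  let ?a = "card (orbit p x)"
  have a: "?a > 0" using assms by simp
  show "diag_length ?a d > 0" using a by (auto simp: diag_length_def elim: evenE)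
  fix n
  let ?y = "(p ^^ d) x"
  have y: "?y \<in> orbit p x" using assms(1) by (rule funpow_in_orbit)
  have eq: "orbit p ?y = orbit p x" using orbit_eq_if_mem[OF assms(1) y] .
  have "(p ^^ n) x = (p ^^ d) x \<longleftrightarrow> n mod ?a = d"
    using funpow_eq_funpow_iff[OF assms(1), of n d] funpow_eq_funpow_iff[OF assms(1), of d n]
      mod_eq_dvd_iff_nat[of n d ?a] mod_eq_dvd_iff_nat[of d n ?a] assms(2)
    by (metis mod_less nat_le_linear)
  moreover have "(p ^^ n) ?y = x \<longleftrightarrow> ?a dvd n + d"
    using funpow_eq_self_iff[OF assms(1), of "n + d"] by (simp add: funpow_add)
  moreover have "(p ^^ n) ?y = ?y \<longleftrightarrow> ?a dvd n"
    using funpow_eq_self_iff[of ?y p n] y eq by simp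
  ultimately show "(pair_map True p ^^ n) (x, ?y) = (x, ?y) \<longleftrightarrow> diag_length ?a d dvd n"
    unfolding diag_length_dvd_iff[OF a assms(2)]
    by (auto simp: pair_map_funpow funpow_eq_self_iff[OF assms(1)])
qed

text \<open>Identifies q_a as the contribution of C \<times> C for one cycle C of length a; the
  outer power ranges over the first coordinate. For odd a the diagonal is one orbit of length a and
  the other a(a-1) pairs form (a-1)/2 orbits of length 2a. For a = 0 modulo 4 there are a orbits of
  length a. For a = 2 modulo 4 the a pairs with d = a/2 form two orbits of length a/2, the rest a-1
  orbits of length a.\<close>

lemma prod_Croot_diag_length:
  assumes "0 < a"
  shows "(\<Prod>d<a. Croot j (diag_length a d)) ^ a = qfun j a"
proof (cases "odd a")
  case True
  have "(\<Prod>d<a. Croot j (diag_length a d)) =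
      Croot j (diag_length a 0) * (\<Prod>d\<in>{..<a} - {0}. Croot j (diag_length a d))"
    using assms by (intro prod.remove) auto
  also have "(\<Prod>d\<in>{..<a} - {0}. Croot j (diag_length a d)) = (\<Prod>d\<in>{..<a} - {0}. Croot j (2 * a))"
    using True by (intro prod.cong) (auto simp: diag_length_def)
  also have "\<dots> = Croot j (2 * a) ^ (a - 1)" using assms by simp
  finally have "(\<Prod>d<a. Croot j (diag_length a d)) ^ a =
      Croot j a ^ (a * 1) * Croot j (2 * a) ^ ((a - 1) * a)"
    by (simp add: diag_length_def power_mult_distrib power_mult)
  also have "(a - 1) * a = 2 * a * ((a - 1) div 2)" using True by (auto elim!: oddE)
  finally show ?thesis
    unfolding Croot_power[OF assms] using Croot_power[of "2 * a" j "(a - 1) div 2"] assms True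
    by (simp add: qfun_def)
next
  case even: False
  show ?thesis
  proof (cases "a mod 4 = 0")
    case True
    have "(\<Prod>d<a. Croot j (diag_length a d)) = (\<Prod>d<a. Croot j a)"
      using even True by (intro prod.cong) (auto simp: diag_length_def)
    then show ?thesis
      using even True Croot_power[OF assms, of j a] by (simp add: qfun_def power_mult)
  next
    case False
    with even have a: "a mod 4 = 2" by presburger
    have "(\<Prod>d<a. Croot j (diag_length a d)) =
        Croot j (diag_length a (a div 2)) * (\<Prod>d\<in>{..<a} - {a div 2}. Croot j (diag_length a d))"
      using assms by (intro prod.remove) auto
    also have "(\<Prod>d\<in>{..<a} - {a div 2}. Croot j (diag_length a d)) = (\<Prod>d\<in>{..<a} - {a div 2}. Croot j a)"
      using even by (intro prod.cong) (auto simp: diag_length_def)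
    also have "\<dots> = Croot j a ^ (a - 1)" using assms by simp
    also have "diag_length a (a div 2) = a div 2"
      using even a assms by (auto simp: diag_length_def)
    finally have "(\<Prod>d<a. Croot j (diag_length a d)) ^ a =
        Croot j (a div 2) ^ (a div 2 * 2) * Croot j a ^ (a * (a - 1))"
      using even by (simp add: power_mult_distrib mult.commute flip: power_mult)
    moreover have "0 < a div 2" using a assms by auto
    ultimately show ?thesis
      using even False Croot_power[OF assms, of j "a - 1"] Croot_power[of "a div 2" j 2]
      by (simp add: qfun_def)
  qed
qed

text \<open>The ab points of C \<times> D, for distinct cycles of lengths a and b, each contribute
  the same root; their product is p_{a,b}.\<close>

lemma pfun_power:
  assumes "a > 0" "b > 0"
  shows "Croot j (lcm 2 (lcm a b)) ^ (a * b * N) = pfun j a b ^ N"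
proof -
  let ?C = "Cfun j (lcm 2 (lcm a b))"
  have "?C \<noteq> 0" using Cfun_pos by (metis less_irrefl)
  then show ?thesis
    by (simp add: Croot_def pfun_def powr_power algebra_simps)
qed

text \<open>The induction adds row and column \<open>Suc n\<close>, which agree by symmetry. This
  turns ordered pairs of lengths into the ranges b < a with the doubled exponent of the stated
  formula.\<close>

lemma prod_off_diagonal:
  fixes f :: "nat \<Rightarrow> nat \<Rightarrow> 'b :: comm_monoid_mult"
  assumes "\<And>a b. f a b = f b a"
  shows "(\<Prod>a=1..n. \<Prod>b\<in>{1..n} - {a}. f a b) = (\<Prod>a=1..n. \<Prod>b=1..a-1. f a b ^ 2)"
proof (induction n)
  case (Suc n)
  have "(\<Prod>b\<in>{1..Suc n} - {a}. f a b) = f a (Suc n) * (\<Prod>b\<in>{1..n} - {a}. f a b)"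
    if "a \<in> {1..n}" for a
  proof -
    have "{1..Suc n} - {a} = insert (Suc n) ({1..n} - {a})" using that by auto
    then show ?thesis by simp
  qed
  moreover have "{1..Suc n} - {Suc n} = {1..n}" by auto
  ultimately have "(\<Prod>a=1..Suc n. \<Prod>b\<in>{1..Suc n} - {a}. f a b) =
      (\<Prod>a=1..n. f a (Suc n)) * (\<Prod>a=1..n. \<Prod>b\<in>{1..n} - {a}. f a b) * (\<Prod>b=1..n. f (Suc n) b)"
    by (simp add: prod.distrib)
  also have "(\<Prod>a=1..n. f a (Suc n)) = (\<Prod>b=1..n. f (Suc n) b)"
    by (rule prod.cong) (auto simp: assms)
  finally show ?case
    using Suc by (simp add: prod_power_distrib[symmetric] power2_eq_square algebra_simps prod.distrib)
qed simp

text \<open>Fixes the first coordinate. Second coordinates on the cycle of \<open>x\<close> give the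
  diagonal factor; the others see the cycle type of \<open>A\<close> with that cycle removed, which
  lowers the count at \<open>b = a\<close> by one.\<close>

lemma prod_Croot_twisted_row:
  assumes A: "finite A" "card A = n" "p permutes A" and x: "x \<in> A"
  defines "k \<equiv> cycle_type p A" and "a \<equiv> card (orbit p x)"
  shows "(\<Prod>y\<in>A. Croot j (card (orbit (pair_map True p) (x, y)))) =
    (\<Prod>d<a. Croot j (diag_length a d)) *
    (\<Prod>b=1..n. Croot j (lcm 2 (lcm a b)) ^ (b * (count k b - (if b = a then 1 else 0))))"
proof -
  have bij: "bij_betw p A A" by (rule permutes_imp_bij[OF A(3)])
  note self = self_in_orbit_if_bij_betw[OF A(1) bij]
  let ?O = "orbit p x" and ?g = "\<lambda>y. Croot j (card (orbit (pair_map True p) (x, y)))"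
  have OA: "?O \<subseteq> A" by (rule orbit_subset_if_bij_betw[OF bij x])
  have O: "?O = (\<lambda>d. (p ^^ d) x) ` {..<a}" and inj: "inj_on (\<lambda>d. (p ^^ d) x) {..<a}"
    using orbit_conv_funpow_dist1[OF self[OF x]] inj_on_funpow_dist1[OF self[OF x]]
    unfolding card_orbit[OF self[OF x], symmetric] a_def by (simp_all add: lessThan_atLeast0)
  have "(\<Prod>y\<in>?O. ?g y) = (\<Prod>d<a. ?g ((p ^^ d) x))"
    using inj by (subst O) (simp add: prod.reindex)
  also have "\<dots> = (\<Prod>d<a. Croot j (diag_length a d))"
    using card_orbit_pair_map_diag[OF self[OF x]] by (intro prod.cong) (auto simp: a_def)
  finally have on: "(\<Prod>y\<in>?O. ?g y) = (\<Prod>d<a. Croot j (diag_length a d))" .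
  have "(\<Prod>y\<in>A - ?O. ?g y) = (\<Prod>y\<in>A - ?O. Croot j (lcm 2 (lcm a (card (orbit p y)))))"
    using card_orbit_pair_map_True[OF self[OF x] self] by (intro prod.cong) (auto simp: a_def)
  also have "\<dots> = (\<Prod>b=1..n. Croot j (lcm 2 (lcm a b)) ^ (b * count (cycle_type p (A - ?O)) b))"
    using A by (intro prod_cycle_type bij_betw_Diff_orbit[OF A(1) bij x]) (auto intro: card_mono)
  also have "\<dots> = (\<Prod>b=1..n. Croot j (lcm 2 (lcm a b)) ^ (b * (count k b - (if b = a then 1 else 0))))"
    using cycle_type_Diff_orbit[OF A(1) bij x] by (intro prod.cong) (auto simp: k_def a_def)
  finally have off: "(\<Prod>y\<in>A - ?O. ?g y) =
      (\<Prod>b=1..n. Croot j (lcm 2 (lcm a b)) ^ (b * (count k b - (if b = a then 1 else 0))))" .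
  show ?thesis
    using prod.subset_diff[OF OA A(1), of ?g] on off by (simp add: mult.commute)
qed

text \<open>Each cycle of length a paired with itself gives q_a. The k_a(k_a - 1) ordered pairs of
  distinct cycles of length a give p_{a,a} each, and different lengths give p_{a,b} once in either
  order.\<close>

lemma card_fixed_twisted:
  fixes m :: nat
  assumes A: "finite A" "card A = n" "p permutes A" and t: "t permutes {1..<m}" "m > 0"
  defines "j \<equiv> cycle_type t {1..<m}" and "k \<equiv> cycle_type p A"
  shows "real (card {F \<in> A \<times> A \<rightarrow>\<^sub>E {..<m}. \<forall>z\<in>A \<times> A. F (pair_map True p z) = t (F z)}) =
    (\<Prod>a=1..n. qfun j a ^ count k a * pfun j a a ^ (count k a ^ 2 - count k a) *
      (\<Prod>b=1..a-1. pfun j a b ^ (2 * count k a * count k b)))"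
proof -
  have bij: "bij_betw p A A" by (rule permutes_imp_bij[OF A(3)])
  define T where "T = (\<lambda>a. \<Prod>d<a. Croot j (diag_length a d))"
  define R where "R = (\<lambda>a. \<Prod>b=1..n. Croot j (lcm 2 (lcm a b)) ^ (b * (count k b - (if b = a then 1 else 0))))"
  have "(\<Prod>x\<in>A. \<Prod>y\<in>A. Croot j (card (orbit (pair_map True p) (x, y)))) =
      (\<Prod>x\<in>A. T (card (orbit p x)) * R (card (orbit p x)))"
    unfolding T_def R_def k_def by (intro prod.cong refl prod_Croot_twisted_row[OF A])
  also have "\<dots> = (\<Prod>a=1..n. (T a * R a) ^ (a * count k a))"
    unfolding k_def by (rule prod_cycle_type[OF A(1) bij]) (use A in simp)
  also have "\<dots> = (\<Prod>a=1..n. qfun j a ^ count k a * pfun j a a ^ (count k a ^ 2 - count k a) *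
      (\<Prod>b\<in>{1..n} - {a}. pfun j a b ^ (count k a * count k b)))"
  proof (intro prod.cong refl)
    fix a assume a: "a \<in> {1..n}"
    have "T a ^ (a * count k a) = qfun j a ^ count k a"
      using prod_Croot_diag_length[of a j] a by (simp add: T_def power_mult)
    moreover have "R a ^ (a * count k a) =
        (\<Prod>b=1..n. pfun j a b ^ (count k a * (count k b - (if b = a then 1 else 0))))"
    proof -
      have "(Croot j (lcm 2 (lcm a b)) ^ (b * (count k b - (if b = a then 1 else 0)))) ^ (a * count k a) =
          pfun j a b ^ (count k a * (count k b - (if b = a then 1 else 0)))" if "b \<in> {1..n}" for b
        using that a pfun_power[of a b j "count k a * (count k b - (if b = a then 1 else 0))"]
        by (simp only: power_mult[symmetric]) (simp add: mult.assoc mult.commute mult.left_commute)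
      then show ?thesis by (simp only: R_def prod_power_distrib cong: prod.cong)
    qed
    moreover have "\<dots> = pfun j a a ^ (count k a ^ 2 - count k a) *
        (\<Prod>b\<in>{1..n} - {a}. pfun j a b ^ (count k a * count k b))"
      using a by (subst prod.remove[of _ a]) (auto simp: power2_eq_square diff_mult_distrib2 intro!: prod.cong)
    ultimately show "(T a * R a) ^ (a * count k a) =
        qfun j a ^ count k a * pfun j a a ^ (count k a ^ 2 - count k a) *
        (\<Prod>b\<in>{1..n} - {a}. pfun j a b ^ (count k a * count k b))"
      by (simp add: power_mult_distrib mult.assoc)
  qed
  also have "\<dots> = (\<Prod>a=1..n. qfun j a ^ count k a * pfun j a a ^ (count k a ^ 2 - count k a) *
      (\<Prod>b=1..a-1. pfun j a b ^ (2 * count k a * count k b)))"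
  proof -
    have "(\<Prod>a=1..n. \<Prod>b\<in>{1..n} - {a}. pfun j a b ^ (count k a * count k b)) =
        (\<Prod>a=1..n. \<Prod>b=1..a-1. (pfun j a b ^ (count k a * count k b)) ^ 2)"
      by (rule prod_off_diagonal) (simp add: pfun_def lcm.commute mult.commute)
    also have "\<dots> = (\<Prod>a=1..n. \<Prod>b=1..a-1. pfun j a b ^ (2 * count k a * count k b))"
      by (intro prod.cong refl) (simp add: ac_simps flip: power_mult)
    finally show ?thesis by (simp only: prod.distrib)
  qed
  finally show ?thesis
    using card_equivariant_pair_map[OF A(1,3) t, of True] by (simp add: j_def)
qed


section \<open>Orbits of multiplication tables\<close>

text \<open>The action of the inverse element supplies the inverse map. The restriction is there
  because members of \<open>Bij E\<close> must be extensional.\<close>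

lemma (in group) group_actionI:
  assumes closed: "\<And>g x. g \<in> carrier G \<Longrightarrow> x \<in> E \<Longrightarrow> act g x \<in> E"
    and one: "\<And>x. x \<in> E \<Longrightarrow> act \<one> x = x"
    and mult: "\<And>g h x. g \<in> carrier G \<Longrightarrow> h \<in> carrier G \<Longrightarrow> x \<in> E \<Longrightarrow> act (g \<otimes> h) x = act g (act h x)"
  shows "group_action G E (\<lambda>g. restrict (act g) E)"
proof -
  have Bij: "restrict (act g) E \<in> Bij E" if g: "g \<in> carrier G" for g
  proof -
    have "act (inv g) (act g x) = x" "act g (act (inv g) x) = x" if "x \<in> E" for x
      using that g by (simp_all add: one flip: mult)
    then have "bij_betw (act g) E E"
      using g by (intro bij_betw_byWitness[where f' = "act (inv g)"]) (auto intro: closed)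
    then show ?thesis by (simp add: Bij_def cong: bij_betw_cong)
  qed
  have "(\<lambda>g. restrict (act g) E) \<in> hom G (BijGroup E)"
  proof (rule homI)
    fix g h assume gh: "g \<in> carrier G" "h \<in> carrier G"
    have "restrict (act (g \<otimes> h)) E = compose E (restrict (act g) E) (restrict (act h) E)"
      using gh by (auto simp: compose_def mult closed)
    then show "restrict (act (g \<otimes> h)) E = restrict (act g) E \<otimes>\<^bsub>BijGroup E\<^esub> restrict (act h) E"
      using Bij gh by (simp add: BijGroup_def)
  qed (use Bij in \<open>simp add: BijGroup_def\<close>)
  then show ?thesis
    unfolding group_action_def group_hom_def group_hom_axioms_def
    using group_axioms group_BijGroup by blast
qed

lemma pair_map_comp: "pair_map s f (pair_map s' f' z) = pair_map (s \<noteq> s') (f \<circ> f') z"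
  by (cases z) (auto simp: pair_map_def)

lemma pair_map_False_id [simp]: "pair_map False id z = z"
  by (cases z) (simp add: pair_map_def)

lemma pair_map_in:
  assumes "p permutes A" "z \<in> A \<times> A"
  shows "pair_map s p z \<in> A \<times> A"
  using assms(2) permutes_in_image[OF assms(1)] by (auto simp: pair_map_def)

text \<open>The Boolean component of a group element tells whether the two arguments are exchanged; it accounts
  for anti-isomorphisms.\<close>

definition table_group :: "'a set \<Rightarrow> nat \<Rightarrow> (('a \<Rightarrow> 'a) \<times> (nat \<Rightarrow> nat) \<times> bool) monoid" where
  "table_group A m = \<lparr>carrier = {p. p permutes A} \<times> {t. t permutes {1..<m}} \<times> UNIV,
     monoid.mult = (\<lambda>(p, t, s) (p', t', s'). (p \<circ> p', t \<circ> t', s \<noteq> s')), one = (id, id, False)\<rparr>"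

text \<open>The inverse of \<open>p\<close> makes this a left action; since the exchange is an
  involution commuting with \<open>p\<close>, the flag \<open>s\<close> needs no inversion.\<close>

definition table_act ::
  "'a set \<Rightarrow> ('a \<Rightarrow> 'a) \<times> (nat \<Rightarrow> nat) \<times> bool \<Rightarrow> ('a \<times> 'a \<Rightarrow> nat) \<Rightarrow> 'a \<times> 'a \<Rightarrow> nat" where
  "table_act A = (\<lambda>(p, t, s) F. \<lambda>z\<in>A \<times> A. t (F (pair_map s (inv_into UNIV p) z)))"

definition tables :: "'a set \<Rightarrow> nat \<Rightarrow> ('a \<times> 'a \<Rightarrow> nat) set" where
  "tables A m = (A \<times> A \<rightarrow>\<^sub>E {..<m})"

definition table_rel :: "'a set \<Rightarrow> nat \<Rightarrow> (('a \<times> 'a \<Rightarrow> nat) \<times> ('a \<times> 'a \<Rightarrow> nat)) set" where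
  "table_rel A m = {(F, F'). F \<in> tables A m \<and> F' \<in> tables A m \<and>
     (\<exists>p t s. p permutes A \<and> t permutes {1..<m} \<and> (\<forall>z\<in>A \<times> A. F' (pair_map s p z) = t (F z)))}"

lemma finite_tables: "finite A \<Longrightarrow> finite (tables A m)"
  unfolding tables_def by (intro finite_PiE) auto

lemma group_table_group: "group (table_group A m)"
proof (rule groupI)
  fix g assume "g \<in> carrier (table_group A m)"
  then obtain p t s where g: "g = (p, t, s)" "p permutes A" "t permutes {1..<m}"
    by (auto simp: table_group_def)
  then have "(inv_into UNIV p, inv_into UNIV t, s) \<in> carrier (table_group A m)"
    "(inv_into UNIV p, inv_into UNIV t, s) \<otimes>\<^bsub>table_group A m\<^esub> g = \<one>\<^bsub>table_group A m\<^esub>"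
    by (auto simp: table_group_def permutes_inv permutes_inv_o)
  then show "\<exists>h\<in>carrier (table_group A m). h \<otimes>\<^bsub>table_group A m\<^esub> g = \<one>\<^bsub>table_group A m\<^esub>"
    by blast
qed (auto simp: table_group_def permutes_compose permutes_id)

lemma permutes_lessThan:
  assumes "t permutes {1..<m}" "b < (m :: nat)"
  shows "t b < m"
proof -
  have "t permutes {..<m}" by (rule permutes_subset[OF assms(1)]) auto
  then show ?thesis using permutes_in_image[of t "{..<m}" b] assms(2) by simp
qed

lemma table_act_closed:
  assumes "g \<in> carrier (table_group A m)" "F \<in> tables A m"
  shows "table_act A g F \<in> tables A m"
proof -
  obtain p t s where g: "g = (p, t, s)" "p permutes A" "t permutes {1..<m}"
    using assms(1) by (auto simp: table_group_def)
  have "t (F (pair_map s (inv_into UNIV p) z)) < m" if "z \<in> A \<times> A" for z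
    using pair_map_in[OF permutes_inv[OF g(2)] that, of s] assms(2)
    by (intro permutes_lessThan[OF g(3)]) (auto simp: tables_def)
  then show ?thesis by (auto simp: g(1) table_act_def tables_def)
qed

text \<open>Removes the inverse from the action. With \<open>F' = F\<close> the right-hand side is
  exactly equivariance, so the tables fixed by a group element are those already counted.\<close>

lemma table_act_eq_iff:
  assumes p: "p permutes A" and F': "F' \<in> tables A m"
  shows "table_act A (p, t, s) F = F' \<longleftrightarrow> (\<forall>z\<in>A \<times> A. F' (pair_map s p z) = t (F z))"
proof -
  let ?q = "inv_into UNIV p"
  have q: "?q permutes A" by (rule permutes_inv[OF p])
  have inv: "pair_map s ?q (pair_map s p z) = z" "pair_map s p (pair_map s ?q z) = z" for z
    by (simp_all add: pair_map_comp permutes_inv_o[OF p])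
  show ?thesis
  proof
    assume "table_act A (p, t, s) F = F'"
    then show "\<forall>z\<in>A \<times> A. F' (pair_map s p z) = t (F z)"
      using pair_map_in[OF p] by (auto simp: table_act_def inv)
  next
    assume h: "\<forall>z\<in>A \<times> A. F' (pair_map s p z) = t (F z)"
    show "table_act A (p, t, s) F = F'"
    proof
      fix z
      show "table_act A (p, t, s) F z = F' z"
      proof (cases "z \<in> A \<times> A")
        case True
        then have "F' (pair_map s p (pair_map s ?q z)) = t (F (pair_map s ?q z))"
          using h pair_map_in[OF q True] by blast
        then show ?thesis using True by (simp add: table_act_def inv)
      next
        case False
        then show ?thesis using F' PiE_arb[of F' "A \<times> A" _ z] by (auto simp: table_act_def tables_def)
      qed
    qed
  qed
qed

lemma group_action_tables:
  "group_action (table_group A m) (tables A m) (\<lambda>g. restrict (table_act A g) (tables A m))"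
proof (rule group.group_actionI[OF group_table_group])
  fix F assume F: "F \<in> tables A m"
  show "table_act A \<one>\<^bsub>table_group A m\<^esub> F = F"
    using table_act_eq_iff[OF permutes_id F, of id False F] by (simp add: table_group_def)
  fix g h assume gh: "g \<in> carrier (table_group A m)" "h \<in> carrier (table_group A m)"
  obtain p t s where g: "g = (p, t, s)" "p permutes A" "t permutes {1..<m}"
    using gh(1) by (auto simp: table_group_def)
  obtain p' t' s' where h: "h = (p', t', s')" "p' permutes A" "t' permutes {1..<m}"
    using gh(2) by (auto simp: table_group_def)
  define F' where "F' = table_act A h F"
  define F'' where "F'' = table_act A g F'"
  have F': "F' \<in> tables A m" unfolding F'_def by (rule table_act_closed[OF gh(2) F])
  have F'': "F'' \<in> tables A m" unfolding F''_def by (rule table_act_closed[OF gh(1) F'])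
  have "\<forall>z\<in>A \<times> A. F' (pair_map s' p' z) = t' (F z)"
    using table_act_eq_iff[OF h(2) F', of t' s' F] h(1) by (simp add: F'_def)
  moreover have "\<forall>z\<in>A \<times> A. F'' (pair_map s p z) = t (F' z)"
    using table_act_eq_iff[OF g(2) F'', of t s F'] g(1) by (simp add: F''_def)
  ultimately have "\<forall>z\<in>A \<times> A. F'' (pair_map (s \<noteq> s') (p \<circ> p') z) = (t \<circ> t') (F z)"
    using pair_map_in[OF h(2)] by (simp only: pair_map_comp[symmetric] o_apply) metis
  then have "table_act A (p \<circ> p', t \<circ> t', s \<noteq> s') F = F''"
    using table_act_eq_iff[OF permutes_compose[OF h(2) g(2)] F''] by blast
  then show "table_act A (g \<otimes>\<^bsub>table_group A m\<^esub> h) F = table_act A g (table_act A h F)"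
    by (simp add: g(1) h(1) table_group_def F''_def F'_def)
qed (rule table_act_closed)

lemma table_rel_Image:
  assumes "F \<in> tables A m"
  shows "table_rel A m `` {F} =
    Group_Action.orbit (table_group A m) (\<lambda>g. restrict (table_act A g) (tables A m)) F"
proof (intro equalityI subsetI)
  fix F' assume "F' \<in> table_rel A m `` {F}"
  then obtain p t s where h: "F' \<in> tables A m" "p permutes A" "t permutes {1..<m}"
    "\<forall>z\<in>A \<times> A. F' (pair_map s p z) = t (F z)" by (auto simp: table_rel_def)
  then have "table_act A (p, t, s) F = F'" using table_act_eq_iff[OF h(2,1)] by blast
  moreover have "(p, t, s) \<in> carrier (table_group A m)" using h by (simp add: table_group_def)
  ultimately show "F' \<in> Group_Action.orbit (table_group A m) (\<lambda>g. restrict (table_act A g) (tables A m)) F"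
    using assms by (auto simp: Group_Action.orbit_def intro!: exI[of _ "(p, t, s)"])
next
  fix F' assume "F' \<in> Group_Action.orbit (table_group A m) (\<lambda>g. restrict (table_act A g) (tables A m)) F"
  then obtain g where g: "g \<in> carrier (table_group A m)" "F' = table_act A g F"
    using assms by (auto simp: Group_Action.orbit_def)
  moreover obtain p t s where "g = (p, t, s)" "p permutes A" "t permutes {1..<m}"
    using g(1) by (auto simp: table_group_def)
  moreover have "F' \<in> tables A m" using g table_act_closed[OF g(1) assms] by simp
  ultimately show "F' \<in> table_rel A m `` {F}"
    using assms table_act_eq_iff[of p A F' m t s F] by (auto simp: table_rel_def)
qed

lemma equiv_table_rel: "equiv (tables A m) (table_rel A m)"
proof -
  interpret group_action "table_group A m" "tables A m" "\<lambda>g. restrict (table_act A g) (tables A m)"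
    by (rule group_action_tables)
  have mem: "(F, F') \<in> table_rel A m \<longleftrightarrow> F \<in> tables A m \<and> F' \<in> tables A m \<and>
      F' \<in> Group_Action.orbit (table_group A m) (\<lambda>g. restrict (table_act A g) (tables A m)) F" for F F'
    using table_rel_Image[of F A m] by (auto simp: table_rel_def)
  show ?thesis
  proof (rule equivI)
    show "table_rel A m \<subseteq> tables A m \<times> tables A m" by (auto simp: table_rel_def)
    show "refl_on (tables A m) (table_rel A m)" by (rule refl_onI) (simp add: mem orbit_refl)
    show "sym (table_rel A m)" by (rule symI) (auto simp: mem intro: orbit_sym)
    show "trans (table_rel A m)" by (rule transI) (auto simp: mem intro: orbit_trans)
  qed
qed

lemma quotient_table_rel:
  "tables A m // table_rel A m =
    orbits (table_group A m) (tables A m) (\<lambda>g. restrict (table_act A g) (tables A m))"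
  using table_rel_Image[of _ A m] by (force simp: quotient_def orbits_def)

lemma invariants_tables:
  assumes "p permutes A"
  shows "invariants (tables A m) (\<lambda>g. restrict (table_act A g) (tables A m)) (p, t, s) =
    {F \<in> A \<times> A \<rightarrow>\<^sub>E {..<m}. \<forall>z\<in>A \<times> A. F (pair_map s p z) = t (F z)}"
  using table_act_eq_iff[OF assms, of _ m t s] by (auto simp: invariants_def simp flip: tables_def)

lemma zden_eq:
  assumes "j \<in> partitions (m - 1)" "k \<in> partitions n"
  shows "zden (n + m) m j k = centralizer_size j * centralizer_size k"
  unfolding zden_def
  by (subst (1 2) centralizer_size_superset[OF finite_atLeastAtMost set_mset_partitions])
     (use assms in auto)

lemma sum_permutes_two_cycle_types:
  fixes G :: "nat multiset \<Rightarrow> nat multiset \<Rightarrow> real"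
  assumes "finite A" "card A = n"
  shows "(\<Sum>p | p permutes A. \<Sum>t | t permutes {1..<m}. G (cycle_type t {1..<m}) (cycle_type p A)) =
    fact n * fact (m - 1) *
    (\<Sum>j\<in>partitions (m - 1). \<Sum>k\<in>partitions n. inverse (zden (n + m) m j k) * G j k)"
proof -
  let ?z = centralizer_size
  have "(\<Sum>p | p permutes A. \<Sum>t | t permutes {1..<m}. G (cycle_type t {1..<m}) (cycle_type p A)) =
      (\<Sum>p | p permutes A. fact (m - 1) * (\<Sum>j\<in>partitions (m - 1). G j (cycle_type p A) / ?z j))"
    by (subst sum_permutes_cycle_type[of "{1..<m}"]) simp_all
  also have "\<dots> = fact n * (\<Sum>k\<in>partitions n. fact (m - 1) * (\<Sum>j\<in>partitions (m - 1). G j k / ?z j) / ?z k)"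
    using assms by (subst sum_permutes_cycle_type) simp_all
  also have "(\<Sum>k\<in>partitions n. fact (m - 1) * (\<Sum>j\<in>partitions (m - 1). G j k / ?z j) / ?z k) =
      fact (m - 1) * (\<Sum>k\<in>partitions n. \<Sum>j\<in>partitions (m - 1). G j k / ?z j / ?z k)"
    by (simp add: sum_distrib_left sum_divide_distrib)
  also have "(\<Sum>k\<in>partitions n. \<Sum>j\<in>partitions (m - 1). G j k / ?z j / ?z k) =
      (\<Sum>j\<in>partitions (m - 1). \<Sum>k\<in>partitions n. G j k / ?z j / ?z k)"
    by (rule sum.swap)
  also have "\<dots> = (\<Sum>j\<in>partitions (m - 1). \<Sum>k\<in>partitions n. inverse (zden (n + m) m j k) * G j k)"
    by (intro sum.cong refl) (simp only: zden_eq, simp add: field_simps)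
  finally show ?thesis by (simp add: mult.assoc)
qed

text \<open>The sums over permutations produce the factors \<open>fact n * fact (m - 1)\<close>,
  which cancel against the group order \<open>fact n * fact (m - 1) * 2\<close>. The remaining 2
  yields the halves in \<open>Lfun\<close>: elements with \<open>s = False\<close> sum to
  \<open>Nfun\<close>, those with \<open>s = True\<close> to the second double sum.\<close>

lemma card_quotient_tables:
  assumes "finite A" "card A = n" "m > 0"
  shows "real (card (tables A m // table_rel A m)) = Lfun (n + m) m"
proof -
  let ?G = "table_group A m" and ?E = "tables A m"
  let ?phi = "\<lambda>g. restrict (table_act A g) ?E"
  let ?P = "{p. p permutes A}" and ?T = "{t. t permutes {1..<m}}"
  define N where "N = (\<lambda>j k. \<Prod>a=1..n. \<Prod>b=1..n. Cfun j (lcm a b) ^ (count k a * count k b * gcd a b))"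
  define M where "M = (\<lambda>j k. \<Prod>a=1..n. qfun j a ^ count k a * pfun j a a ^ (count k a ^ 2 - count k a) *
      (\<Prod>b=1..a-1. pfun j a b ^ (2 * count k a * count k b)))"
  interpret group_action ?G ?E ?phi by (rule group_action_tables)
  have fin: "finite ?P" "finite ?T" using assms(1) by (simp_all add: finite_permutations)
  have car: "carrier ?G = ?P \<times> ?T \<times> UNIV" by (simp add: table_group_def)
  have ord: "order ?G = fact n * fact (m - 1) * 2"
    using assms(1,2) by (simp add: order_def car card_cartesian_product card_permutations)
  have "card (orbits ?G ?E ?phi) * order ?G = (\<Sum>g\<in>carrier ?G. card (invariants ?E ?phi g))"
    by (rule burnside) (use fin finite_tables[OF assms(1)] in \<open>simp_all add: car\<close>)
  also have "\<dots> = (\<Sum>p\<in>?P. \<Sum>t\<in>?T. \<Sum>s\<in>UNIV. card (invariants ?E ?phi (p, t, s)))"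
    by (simp add: car sum.cartesian_product)
  also have "real \<dots> = (\<Sum>p\<in>?P. \<Sum>t\<in>?T. N (cycle_type t {1..<m}) (cycle_type p A) +
      M (cycle_type t {1..<m}) (cycle_type p A))"
    unfolding of_nat_sum
  proof (intro sum.cong refl)
    fix p t assume "p \<in> ?P" "t \<in> ?T"
    then have p: "p permutes A" and t: "t permutes {1..<m}" by auto
    show "(\<Sum>s\<in>UNIV. real (card (invariants ?E ?phi (p, t, s)))) =
        N (cycle_type t {1..<m}) (cycle_type p A) + M (cycle_type t {1..<m}) (cycle_type p A)"
      unfolding UNIV_bool N_def M_def
      using card_fixed_untwisted[OF assms(1,2) p t assms(3)] card_fixed_twisted[OF assms(1,2) p t assms(3)]
      by (simp add: invariants_tables[OF p])
  qed
  also have "\<dots> = fact n * fact (m - 1) *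
      (\<Sum>j\<in>partitions (m - 1). \<Sum>k\<in>partitions n. inverse (zden (n + m) m j k) * (N j k + M j k))"
    by (rule sum_permutes_two_cycle_types[OF assms(1,2)])
  also have "\<dots> = fact n * fact (m - 1) * (2 * Lfun (n + m) m)"
    by (simp add: Lfun_def Nfun_def N_def M_def distrib_left sum.distrib)
  finally show ?thesis by (simp add: ord quotient_table_rel)
qed


section \<open>Nilpotent semigroups of degree 3\<close>

text \<open>\<open>g\<close> preserves and reflects equivalence and meets every class of
  \<open>X\<close>, so it induces a bijection of classes. The relations live on the larger sets
  \<open>U\<close> and \<open>V\<close>, so that parts of a set, such as the tables that are not
  full, can be compared without restricting the relation.\<close>

lemma quotient_transfer:
  assumes R: "equiv U R" "X \<subseteq> U" and S: "equiv V S" "Y \<subseteq> V"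
    and g: "g ` Y \<subseteq> X"
    and iff: "\<And>y y'. y \<in> Y \<Longrightarrow> y' \<in> Y \<Longrightarrow> (y, y') \<in> S \<longleftrightarrow> (g y, g y') \<in> R"
    and rep: "\<And>x. x \<in> X \<Longrightarrow> \<exists>y\<in>Y. (x, g y) \<in> R"
  shows "\<exists>h. bij_betw h (Y // S) (X // R)"
proof -
  let ?u = "\<lambda>y. S `` {y}" and ?v = "\<lambda>y. R `` {g y}"
  have same: "?u y = ?u y' \<longleftrightarrow> ?v y = ?v y'" if "y \<in> Y" "y' \<in> Y" for y y'
  proof -
    have "y \<in> V" "y' \<in> V" "g y \<in> U" "g y' \<in> U" using that S(2) R(2) g by auto
    then show ?thesis
      using eq_equiv_class_iff[OF S(1), of y y'] eq_equiv_class_iff[OF R(1), of "g y" "g y'"] iff[OF that]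
      by simp
  qed
  have Y: "Y // S = ?u ` Y" by (auto simp: quotient_def)
  have "R `` {x} \<in> ?v ` Y" if "x \<in> X" for x
    using rep[OF that] equiv_class_eq[OF R(1)] by blast
  then have X: "X // R = ?v ` Y" using g by (auto simp: quotient_def)
  have "bij_betw (\<lambda>c. ?v (inv_into Y ?u c)) (?u ` Y) (?v ` Y)"
  proof (rule bij_betwI')
    fix c c' assume c: "c \<in> ?u ` Y" "c' \<in> ?u ` Y"
    show "?v (inv_into Y ?u c) = ?v (inv_into Y ?u c') \<longleftrightarrow> c = c'"
      using same[OF inv_into_into[OF c(1)] inv_into_into[OF c(2)]]
      unfolding f_inv_into_f[OF c(1)] f_inv_into_f[OF c(2)] by simp
  next
    fix c assume "c \<in> ?u ` Y"
    then show "?v (inv_into Y ?u c) \<in> ?v ` Y" by (simp add: inv_into_into)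
  next
    fix d assume "d \<in> ?v ` Y"
    then obtain y where y: "y \<in> Y" "d = ?v y" by auto
    then have c: "?u y \<in> ?u ` Y" by blast
    have "?v (inv_into Y ?u (?u y)) = d"
      using same[OF inv_into_into[OF c] y(1)] unfolding f_inv_into_f[OF c] y(2) by simp
    then show "\<exists>c\<in>?u ` Y. d = ?v (inv_into Y ?u c)" using y by blast
  qed
  then show ?thesis using X Y by auto
qed

lemma card_quotient_split:
  assumes R: "equiv X R" and fin: "finite X" and Y: "Y \<subseteq> X"
    and closed: "\<And>x y. (x, y) \<in> R \<Longrightarrow> x \<in> Y \<Longrightarrow> y \<in> Y"
  shows "card (X // R) = card (Y // R) + card ((X - Y) // R)"
proof -
  have X: "X // R = Y // R \<union> (X - Y) // R" using Y by (auto simp: quotient_def)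
  have "Y // R \<inter> (X - Y) // R = {}"
  proof -
    have "R `` {y} \<noteq> R `` {x}" if "y \<in> Y" "x \<in> X - Y" for x y
      using that Y closed[of y x] eq_equiv_class_iff[OF R, of y x] by blast
    then show ?thesis by (auto simp: quotient_def)
  qed
  moreover have "finite (X // R)" using R fin finite_quotient by (metis equiv_def)
  ultimately show ?thesis using X by (metis card_Un_disjoint finite_Un)
qed

text \<open>In a finite set the complements of \<open>U0\<close> and its image have equal size, so
  any bijection between them completes \<open>t\<close>.\<close>

lemma ex_permutes_extend:
  assumes "finite U" "U0 \<subseteq> U" "inj_on t U0" "t ` U0 \<subseteq> U"
  shows "\<exists>t'. t' permutes U \<and> (\<forall>x\<in>U0. t' x = t x)"
proof -
  have "card (U - U0) = card (U - t ` U0)"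
    using assms finite_subset[OF assms(2,1)] finite_subset[OF assms(4,1)]
    by (simp add: card_Diff_subset card_image)
  then obtain h where h: "bij_betw h (U - U0) (U - t ` U0)"
    using assms(1) finite_same_card_bij by blast
  define t' where "t' = (\<lambda>x. if x \<in> U0 then t x else if x \<in> U then h x else x)"
  have "bij_betw t' U0 (t ` U0)"
    using assms(3) by (auto simp: bij_betw_def t'_def inj_on_def)
  moreover have "bij_betw t' (U - U0) (U - t ` U0)"
    using h by (rule bij_betw_cong[THEN iffD1, rotated]) (auto simp: t'_def)
  ultimately have "bij_betw t' (U0 \<union> (U - U0)) (t ` U0 \<union> (U - t ` U0))"
    by (rule bij_betw_combine) auto
  moreover have "U0 \<union> (U - U0) = U" "t ` U0 \<union> (U - t ` U0) = U" using assms by auto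
  ultimately have "t' permutes U"
    using assms(2) by (intro bij_imp_permutes) (auto simp: t'_def)
  then show ?thesis by (auto simp: t'_def)
qed

text \<open>The value 0 is exempt: it is a product in any case, since every product with a factor
  outside \<open>A\<close> is zero.\<close>

definition full_tables :: "'a set \<Rightarrow> nat \<Rightarrow> ('a \<times> 'a \<Rightarrow> nat) set" where
  "full_tables A m = {F \<in> tables A m. {1..<m} \<subseteq> F ` (A \<times> A)}"

lemma full_tables_closed:
  assumes "(F, F') \<in> table_rel A m" "F \<in> full_tables A m"
  shows "F' \<in> full_tables A m"
proof -
  obtain p t s where h: "F' \<in> tables A m" "p permutes A" "t permutes {1..<m}"
    "\<forall>z\<in>A \<times> A. F' (pair_map s p z) = t (F z)"
    using assms(1) by (auto simp: table_rel_def)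
  have "b \<in> F' ` (A \<times> A)" if "b \<in> {1..<m}" for b
  proof -
    have "b \<in> t ` {1..<m}" using that permutes_image[OF h(3)] by simp
    then obtain z where z: "z \<in> A \<times> A" "b = t (F z)"
      using assms(2) by (auto simp: full_tables_def)
    then have "b = F' (pair_map s p z)" using h(4) by metis
    then show ?thesis using pair_map_in[OF h(2) z(1)] by blast
  qed
  then show ?thesis using h(1) by (auto simp: full_tables_def)
qed

text \<open>Up to equivalence, a table missing some value in \<open>{1..<m}\<close> misses the value \<open>m - 1\<close>.\<close>

lemma card_quotient_not_full:
  assumes m: "m \<ge> 2"
  shows "card ((tables A m - full_tables A m) // table_rel A m) =
    card (tables A (m - 1) // table_rel A (m - 1))"
proof -
  have sub: "tables A (m - 1) \<subseteq> tables A m" by (force simp: tables_def PiE_iff)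
  have "\<exists>h. bij_betw h (tables A (m - 1) // table_rel A (m - 1))
      ((tables A m - full_tables A m) // table_rel A m)"
  proof (rule quotient_transfer[where g = id, OF equiv_table_rel _ equiv_table_rel])
    show "id ` tables A (m - 1) \<subseteq> tables A m - full_tables A m"
    proof
      fix F assume "F \<in> id ` tables A (m - 1)"
      then have F: "F \<in> tables A (m - 1)" by simp
      have "m - 1 \<notin> F ` (A \<times> A)" using F by (force simp: tables_def PiE_iff)
      moreover have "m - 1 \<in> {1..<m}" using m by auto
      ultimately have "F \<notin> full_tables A m" unfolding full_tables_def by blast
      then show "F \<in> tables A m - full_tables A m" using F sub by blast
    qed
  next
    fix F F' assume F: "F \<in> tables A (m - 1)" and F': "F' \<in> tables A (m - 1)"
    show "(F, F') \<in> table_rel A (m - 1) \<longleftrightarrow> (id F, id F') \<in> table_rel A m"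
    proof
      assume "(F, F') \<in> table_rel A (m - 1)"
      then obtain p t s where h: "p permutes A" "t permutes {1..<m - 1}"
        "\<forall>z\<in>A \<times> A. F' (pair_map s p z) = t (F z)"
        by (auto simp: table_rel_def)
      moreover have "t permutes {1..<m}" by (rule permutes_subset[OF h(2)]) auto
      ultimately show "(id F, id F') \<in> table_rel A m" using F F' sub by (auto simp: table_rel_def)
    next
      assume "(id F, id F') \<in> table_rel A m"
      then obtain p t s where h: "p permutes A" "t permutes {1..<m}"
        "\<forall>z\<in>A \<times> A. F' (pair_map s p z) = t (F z)"
        by (auto simp: table_rel_def)
      \<comment> \<open>\<open>t\<close> may move \<open>m - 1\<close>, but only its effect on the
        attained nonzero values \<open>?V\<close> matters. It maps these into \<open>?U\<close>,
        where the restriction extends to a permutation.\<close>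
      let ?U = "{1..<m - 1}" and ?V = "F ` (A \<times> A) - {0}"
      have t0: "t 0 = 0" using h(2) by (rule permutes_not_in) simp
      have inj: "inj t" by (rule permutes_inj[OF h(2)])
      have "?V \<subseteq> ?U" using F by (force simp: tables_def PiE_iff)
      moreover have "inj_on t ?V" using inj by (rule inj_on_subset) simp
      moreover have "t ` ?V \<subseteq> ?U"
      proof
        fix c assume "c \<in> t ` ?V"
        then obtain z where z: "z \<in> A \<times> A" "F z \<noteq> 0" "c = t (F z)" by auto
        then have "c = F' (pair_map s p z)" using h(3) by metis
        then have "c < m - 1"
          using F' pair_map_in[OF h(1) z(1), of s] by (auto simp: tables_def PiE_iff)
        then show "c \<in> ?U" using z t0 inj injD[of t "F z" 0] by (cases "c = 0") auto
      qed
      ultimately obtain t' where t': "t' permutes ?U" "\<forall>x\<in>?V. t' x = t x"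
        using ex_permutes_extend[of ?U ?V t] by auto
      have "t' 0 = 0" using t'(1) by (rule permutes_not_in) simp
      then have "t' (F z) = t (F z)" if "z \<in> A \<times> A" for z
        using that t'(2) t0 by (cases "F z = 0") auto
      then have "\<forall>z\<in>A \<times> A. F' (pair_map s p z) = t' (F z)" using h(3) by metis
      then show "(F, F') \<in> table_rel A (m - 1)"
        using F F' h(1) t'(1) unfolding table_rel_def by blast
    qed
  next
    fix F assume "F \<in> tables A m - full_tables A m"
    then have F: "F \<in> tables A m" and "\<not> {1..<m} \<subseteq> F ` (A \<times> A)"
      unfolding full_tables_def by blast+
    then obtain b where b: "b \<in> {1..<m}" "b \<notin> F ` (A \<times> A)" by blast
    define t where "t = Transposition.transpose b (m - 1)"
    have t: "t permutes {1..<m}" unfolding t_def by (rule permutes_swap_id) (use b in auto)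
    define F' where "F' = (\<lambda>z\<in>A \<times> A. t (F z))"
    have "t (F z) < m - 1" if "z \<in> A \<times> A" for z
    proof -
      have "F z < m" using F that by (auto simp: tables_def PiE_iff)
      moreover have "F z \<noteq> b" using that b by auto
      moreover have "t b = m - 1" by (simp add: t_def)
      ultimately have "t (F z) < m" "t (F z) \<noteq> m - 1"
        using permutes_lessThan[OF t] permutes_inj[OF t] by (blast, metis injD)
      then show ?thesis by linarith
    qed
    then have F': "F' \<in> tables A (m - 1)" by (auto simp: F'_def tables_def)
    have "\<forall>z\<in>A \<times> A. F' (pair_map False id z) = t (F z)" by (simp add: F'_def)
    then have "(F, F') \<in> table_rel A m"
      using F F' sub t permutes_id[of A] unfolding table_rel_def by blast
    then show "\<exists>F'\<in>tables A (m - 1). (F, id F') \<in> table_rel A m" using F' by auto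
  qed auto
  then show ?thesis by (metis bij_betw_same_card)
qed

text \<open>Dropping a value leaves \<open>A\<close> unchanged, so the order \<open>n + m\<close>
  and the number \<open>m\<close> of products decrease together; this is why both arguments of the
  subtracted L are shifted.\<close>

lemma card_quotient_full_tables:
  assumes "finite A" "card A = n" "m \<ge> 2"
  shows "real (card (full_tables A m // table_rel A m)) = Lfun (n + m) m - Lfun (n + (m - 1)) (m - 1)"
proof -
  have "card (tables A m // table_rel A m) =
      card (full_tables A m // table_rel A m) + card ((tables A m - full_tables A m) // table_rel A m)"
  proof (rule card_quotient_split[OF equiv_table_rel finite_tables[OF assms(1)]])
    show "full_tables A m \<subseteq> tables A m" by (auto simp: full_tables_def)
  qed (rule full_tables_closed)
  then show ?thesis
    using card_quotient_tables[OF assms(1,2), of m] card_quotient_tables[OF assms(1,2), of "m - 1"]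
      card_quotient_not_full[OF assms(3), of A] assms(3) by simp
qed

section \<open>Semigroups as full tables\<close>

definition square_set :: "nat \<Rightarrow> (nat \<Rightarrow> nat \<Rightarrow> nat) \<Rightarrow> nat set" where
  "square_set n mm = {mm x y | x y. x < n \<and> y < n}"

lemma square_setI: "x < n \<Longrightarrow> y < n \<Longrightarrow> mm x y \<in> square_set n mm"
  by (auto simp: square_set_def)

lemma nil3_closed: "mm \<in> nil3_semigroups n \<Longrightarrow> x < n \<Longrightarrow> y < n \<Longrightarrow> mm x y < n"
  by (simp add: nil3_semigroups_def nilpotent3_on_def is_semigroup_on_def)

lemma square_set_subset: "mm \<in> nil3_semigroups n \<Longrightarrow> square_set n mm \<subseteq> {0..<n}"
  using nil3_closed by (fastforce simp: square_set_def)

lemma equiv_iso_anti_rel: "equiv (nil3_semigroups n) (iso_anti_rel n)"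
proof (rule equivI)
  show "iso_anti_rel n \<subseteq> nil3_semigroups n \<times> nil3_semigroups n" by (auto simp: iso_anti_rel_def)
  show "refl_on (nil3_semigroups n) (iso_anti_rel n)"
    by (rule refl_onI) (auto simp: iso_anti_rel_def iso_or_anti_def intro!: exI[of _ id])
  show "sym (iso_anti_rel n)"
  proof (rule symI)
    fix m1 m2 assume "(m1, m2) \<in> iso_anti_rel n"
    then obtain f where m: "m1 \<in> nil3_semigroups n" "m2 \<in> nil3_semigroups n"
      and f: "bij_betw f {0..<n} {0..<n}" and iso: "(\<forall>x<n. \<forall>y<n. f (m1 x y) = m2 (f x) (f y)) \<or>
        (\<forall>x<n. \<forall>y<n. f (m1 x y) = m2 (f y) (f x))"
      by (auto simp: iso_anti_rel_def iso_or_anti_def)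
    define g where "g = inv_into {0..<n} f"
    have g: "bij_betw g {0..<n} {0..<n}" unfolding g_def by (rule bij_betw_inv_into[OF f])
    have gn: "g x < n" "f (g x) = x" if "x < n" for x
      using that g bij_betw_inv_into_right[OF f] by (auto simp: g_def bij_betw_def)
    have gf: "g (f x) = x" if "x < n" for x
      using that bij_betw_inv_into_left[OF f] by (simp add: g_def)
    have "(\<forall>x<n. \<forall>y<n. g (m2 x y) = m1 (g x) (g y)) \<or> (\<forall>x<n. \<forall>y<n. g (m2 x y) = m1 (g y) (g x))"
      using iso
    proof
      assume h: "\<forall>x<n. \<forall>y<n. f (m1 x y) = m2 (f x) (f y)"
      have "g (m2 x y) = m1 (g x) (g y)" if "x < n" "y < n" for x y
        using h gn[OF that(1)] gn[OF that(2)] gf[OF nil3_closed[OF m(1), of "g x" "g y"]] by metis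
      then show ?thesis by blast
    next
      assume h: "\<forall>x<n. \<forall>y<n. f (m1 x y) = m2 (f y) (f x)"
      have "g (m2 x y) = m1 (g y) (g x)" if "x < n" "y < n" for x y
        using h gn[OF that(1)] gn[OF that(2)] gf[OF nil3_closed[OF m(1), of "g y" "g x"]] by metis
      then show ?thesis by blast
    qed
    then show "(m2, m1) \<in> iso_anti_rel n"
      using m g by (auto simp: iso_anti_rel_def iso_or_anti_def)
  qed
  show "trans (iso_anti_rel n)"
  proof (rule transI)
    fix m1 m2 m3 assume "(m1, m2) \<in> iso_anti_rel n" "(m2, m3) \<in> iso_anti_rel n"
    then obtain f g where m: "m1 \<in> nil3_semigroups n" "m3 \<in> nil3_semigroups n"
      and f: "bij_betw f {0..<n} {0..<n}" and f_iso: "(\<forall>x<n. \<forall>y<n. f (m1 x y) = m2 (f x) (f y)) \<or>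
        (\<forall>x<n. \<forall>y<n. f (m1 x y) = m2 (f y) (f x))"
      and g: "bij_betw g {0..<n} {0..<n}" and g_iso: "(\<forall>x<n. \<forall>y<n. g (m2 x y) = m3 (g x) (g y)) \<or>
        (\<forall>x<n. \<forall>y<n. g (m2 x y) = m3 (g y) (g x))"
      by (auto simp: iso_anti_rel_def iso_or_anti_def)
    have "f x < n" if "x < n" for x using f that by (auto simp: bij_betw_def)
    then have "(\<forall>x<n. \<forall>y<n. (g \<circ> f) (m1 x y) = m3 ((g \<circ> f) x) ((g \<circ> f) y)) \<or>
        (\<forall>x<n. \<forall>y<n. (g \<circ> f) (m1 x y) = m3 ((g \<circ> f) y) ((g \<circ> f) x))"
      using f_iso g_iso by (elim disjE) simp_all
    then show "(m1, m3) \<in> iso_anti_rel n"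
      using m bij_betw_trans[OF f g] unfolding iso_anti_rel_def iso_or_anti_def by blast
  qed
qed

lemma image_square_set:
  assumes "bij_betw f {0..<n} {0..<n}"
    and "(\<forall>x<n. \<forall>y<n. f (m1 x y) = m2 (f x) (f y)) \<or> (\<forall>x<n. \<forall>y<n. f (m1 x y) = m2 (f y) (f x))"
  shows "f ` square_set n m1 = square_set n m2"
proof -
  have f: "f x < n" if "x < n" for x using assms(1) that by (auto simp: bij_betw_def)
  have "f (m1 x y) \<in> square_set n m2" if "x < n" "y < n" for x y
  proof -
    have "f (m1 x y) = m2 (f x) (f y) \<or> f (m1 x y) = m2 (f y) (f x)"
      using assms(2) that by blast
    then show ?thesis using square_setI[OF f f, of _ _ m2] that by metis
  qed
  then have "f ` square_set n m1 \<subseteq> square_set n m2" by (auto simp: square_set_def)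
  moreover have "m2 x y \<in> f ` square_set n m1" if "x < n" "y < n" for x y
  proof -
    have "x \<in> f ` {0..<n}" "y \<in> f ` {0..<n}" using that assms(1) by (simp_all add: bij_betw_def)
    then obtain x' y' where x': "x' < n" "x = f x'" "y' < n" "y = f y'" by auto
    then have "m2 x y = f (m1 x' y') \<or> m2 x y = f (m1 y' x')" using assms(2) by metis
    then show ?thesis using square_setI[OF x'(1,3)] square_setI[OF x'(3,1)] by blast
  qed
  ultimately show ?thesis by (auto simp: square_set_def)
qed

lemma card_square_set_iso:
  assumes "(m1, m2) \<in> iso_anti_rel n"
  shows "card (square_set n m1) = card (square_set n m2)"
proof -
  obtain f where m: "m1 \<in> nil3_semigroups n" and f: "bij_betw f {0..<n} {0..<n}"
    and iso: "(\<forall>x<n. \<forall>y<n. f (m1 x y) = m2 (f x) (f y)) \<or> (\<forall>x<n. \<forall>y<n. f (m1 x y) = m2 (f y) (f x))"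
    using assms by (auto simp: iso_anti_rel_def iso_or_anti_def)
  have "inj_on f (square_set n m1)"
    using f square_set_subset[OF m] by (metis bij_betw_def inj_on_subset)
  then show ?thesis using image_square_set[OF f iso] card_image by metis
qed

text \<open>The carrier is split as \<open>{..<m} \<union> A\<close>, where \<open>{..<m}\<close> will be the set of products and \<open>0\<close> the zero.\<close>

definition table_mult :: "nat set \<Rightarrow> (nat \<times> nat \<Rightarrow> nat) \<Rightarrow> nat \<Rightarrow> nat \<Rightarrow> nat" where
  "table_mult A F x y = (if x \<in> A \<and> y \<in> A then F (x, y) else 0)"

context
  fixes n m :: nat and A :: "nat set"
  assumes m: "2 \<le> m" "m \<le> n" and A: "A = {m..<n}"
begin

lemma table_mult_less:
  assumes "F \<in> tables A m"
  shows "table_mult A F x y < m"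
  using assms m by (auto simp: table_mult_def tables_def PiE_iff)

lemma table_mult_zero:
  assumes "x < m \<or> y < m"
  shows "table_mult A F x y = 0"
  using assms A by (auto simp: table_mult_def)

lemma square_set_table_mult:
  assumes "F \<in> full_tables A m"
  shows "square_set n (table_mult A F) = {0..<m}"
proof (intro equalityI subsetI)
  have F: "F \<in> tables A m" using assms by (simp add: full_tables_def)
  fix c
  {
    assume "c \<in> square_set n (table_mult A F)"
    then show "c \<in> {0..<m}" using table_mult_less[OF F] by (auto simp: square_set_def)
  next
    assume c: "c \<in> {0..<m}"
    show "c \<in> square_set n (table_mult A F)"
    proof (cases "c = 0")
      case True
      then have "c = table_mult A F 0 0" using m table_mult_zero[of 0 0 F] by simp
      then show ?thesis using m by (force simp: square_set_def)
    next
      case False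
      then have "c \<in> F ` (A \<times> A)" using c assms by (auto simp: full_tables_def)
      then obtain x y where xy: "x \<in> A" "y \<in> A" "c = F (x, y)" by auto
      then have "c = table_mult A F x y" by (simp add: table_mult_def)
      then show ?thesis using xy A by (auto simp: square_set_def)
    qed
  }
qed

lemma table_mult_nil3:
  assumes "F \<in> full_tables A m"
  shows "table_mult A F \<in> nil3_semigroups n"
proof -
  have F: "F \<in> tables A m" using assms by (simp add: full_tables_def)
  have zero: "table_mult A F (table_mult A F x y) z = 0" "table_mult A F x (table_mult A F y z) = 0"
    for x y z using table_mult_zero table_mult_less[OF F] by blast+
  have "{table_mult A F (table_mult A F x y) z | x y z. x < n \<and> y < n \<and> z < n} = {0}"
    using m by (auto simp: zero intro!: exI[of _ 0])
  then have "card {table_mult A F (table_mult A F x y) z | x y z. x < n \<and> y < n \<and> z < n} = 1"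
    by (metis is_singletonI is_singleton_altdef)
  moreover have "card {table_mult A F x y | x y. x < n \<and> y < n} > 1"
    using square_set_table_mult[OF assms] m by (simp add: square_set_def)
  moreover have "table_mult A F x y < n" for x y
    using table_mult_less[OF F, of x y] m by linarith
  ultimately show ?thesis
    by (auto simp: nil3_semigroups_def nilpotent3_on_def is_semigroup_on_def zero)
qed

lemma table_rel_imp_iso:
  assumes F: "F \<in> full_tables A m" and F': "F' \<in> full_tables A m"
    and rel: "(F, F') \<in> table_rel A m"
  shows "(table_mult A F, table_mult A F') \<in> iso_anti_rel n"
proof -
  obtain p t s where h: "p permutes A" "t permutes {1..<m}"
    "\<forall>z\<in>A \<times> A. F' (pair_map s p z) = t (F z)"
    using rel by (auto simp: table_rel_def)
  \<comment> \<open>The two permutations move points of the disjoint sets \<open>A\<close> and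
    \<open>{1..<m}\<close>, so \<open>f\<close> acts as \<open>p\<close> on the former and as
    \<open>t\<close> on products.\<close>
  define f where "f = p \<circ> t"
  have "p permutes {0..<n}" by (rule permutes_subset[OF h(1)]) (use A in auto)
  moreover have "t permutes {0..<n}" by (rule permutes_subset[OF h(2)]) (use m in auto)
  ultimately have "f permutes {0..<n}" unfolding f_def by (intro permutes_compose)
  then have bij: "bij_betw f {0..<n} {0..<n}" by (rule permutes_imp_bij)
  have fA: "f x = p x" if "x \<in> A" for x
    using that A permutes_not_in[OF h(2), of x] by (simp add: f_def)
  have fB: "f x = t x" if "x < m" for x
    using permutes_lessThan[OF h(2) that] A permutes_not_in[OF h(1), of "t x"] by (simp add: f_def)
  have mem: "f x \<in> A \<longleftrightarrow> x \<in> A" if "x < n" for x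
    using that fA[of x] fB[of x] permutes_in_image[OF h(1)] permutes_lessThan[OF h(2), of x] A
    by (cases "x < m") auto
  have t0: "t 0 = 0" using h(2) by (rule permutes_not_in) simp
  have FT: "F \<in> tables A m" using F by (simp add: full_tables_def)
  have "f (table_mult A F x y) =
      (if s then table_mult A F' (f y) (f x) else table_mult A F' (f x) (f y))" if "x < n" "y < n" for x y
  proof -
    have "f (table_mult A F x y) = t (table_mult A F x y)"
      using fB table_mult_less[OF FT] by blast
    also have "\<dots> = (if s then table_mult A F' (f y) (f x) else table_mult A F' (f x) (f y))"
    proof (cases "x \<in> A \<and> y \<in> A")
      case True
      then have "F' (pair_map s p (x, y)) = t (F (x, y))" using h(3) by blast
      then show ?thesis
        using True fA mem that by (simp add: table_mult_def pair_map_def permutes_in_image[OF h(1)] split: if_splits)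
    next
      case False
      then show ?thesis using mem that t0 by (auto simp: table_mult_def)
    qed
    finally show ?thesis .
  qed
  then have "iso_or_anti n (table_mult A F) (table_mult A F')"
    unfolding iso_or_anti_def using bij by (cases s) (auto intro!: exI[of _ f])
  then show ?thesis
    using table_mult_nil3[OF F] table_mult_nil3[OF F'] by (simp add: iso_anti_rel_def)
qed

text \<open>An (anti-)isomorphism \<open>f\<close> preserves the set of products
  \<open>{0..<m}\<close>, hence also its complement \<open>A\<close>. It fixes 0 because 0 is the
  product of 0 with itself and \<open>f 0\<close>, being below \<open>m\<close>, squares to 0. The
  restrictions of \<open>f\<close> to \<open>A\<close> and \<open>{1..<m}\<close> are then the
  required permutations.\<close>

lemma iso_imp_table_rel:
  assumes F: "F \<in> full_tables A m" and F': "F' \<in> full_tables A m"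
    and rel: "(table_mult A F, table_mult A F') \<in> iso_anti_rel n"
  shows "(F, F') \<in> table_rel A m"
proof -
  have FT: "F \<in> tables A m" "F' \<in> tables A m" using F F' by (simp_all add: full_tables_def)
  obtain f where f: "bij_betw f {0..<n} {0..<n}" and
    iso: "(\<forall>x<n. \<forall>y<n. f (table_mult A F x y) = table_mult A F' (f x) (f y)) \<or>
      (\<forall>x<n. \<forall>y<n. f (table_mult A F x y) = table_mult A F' (f y) (f x))"
    using rel by (auto simp: iso_anti_rel_def iso_or_anti_def)
  have img: "f ` {0..<m} = {0..<m}"
    using image_square_set[OF f iso] by (simp add: square_set_table_mult F F')
  moreover have "inj_on f {0..<m}"
    by (rule inj_on_subset[OF bij_betw_imp_inj_on[OF f]]) (use m in auto)
  ultimately have fm: "bij_betw f {0..<m} {0..<m}" by (simp add: bij_betw_def)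
  have "f 0 < m" using img m by (metis atLeastLessThan_iff imageI le0 less_le_trans zero_less_numeral)
  then have "table_mult A F' (f 0) (f 0) = 0" by (simp add: table_mult_zero)
  moreover have "table_mult A F 0 0 = 0" using m by (simp add: table_mult_zero)
  ultimately have f0: "f 0 = 0" using iso m by (metis less_le_trans zero_less_numeral)
  have "bij_betw f ({0..<m} - {0}) ({0..<m} - {0})"
    using bij_betw_DiffI[OF fm, of "{0}" "{0}"] f0 m by (simp add: bij_betw_def)
  moreover have "{0..<m} - {0} = {1..<m}" by auto
  ultimately have f1: "bij_betw f {1..<m} {1..<m}" by simp
  have "bij_betw f ({0..<n} - {0..<m}) ({0..<n} - {0..<m})"
    using bij_betw_DiffI[OF f fm] m by auto
  moreover have "{0..<n} - {0..<m} = A" using A by auto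
  ultimately have fA: "bij_betw f A A" by simp
  define p where "p = perm_restrict f A"
  define t where "t = perm_restrict f {1..<m}"
  have p: "p permutes A"
    unfolding p_def by (rule perm_restrict_permutes[OF fA])
  have t: "t permutes {1..<m}"
    unfolding t_def by (rule perm_restrict_permutes[OF f1])
  have pf: "p x = f x" "x < n" "f x \<in> A" if "x \<in> A" for x
    using that fA A by (auto simp: p_def perm_restrict_def bij_betw_def)
  have tf: "t c = f c" if "c < m" for c
    using that f0 by (cases "c = 0") (auto simp: t_def perm_restrict_def)
  have Fm: "F z < m" if "z \<in> A \<times> A" for z using FT that by (auto simp: tables_def PiE_iff)
  have "\<exists>s. \<forall>z\<in>A \<times> A. F' (pair_map s p z) = t (F z)"
    using iso
  proof
    assume h: "\<forall>x<n. \<forall>y<n. f (table_mult A F x y) = table_mult A F' (f x) (f y)"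
    have "F' (pair_map False p (x, y)) = t (F (x, y))" if "x \<in> A" "y \<in> A" for x y
      using h[rule_format, OF pf(2)[OF that(1)] pf(2)[OF that(2)]] that pf Fm tf
      by (simp add: table_mult_def pair_map_def)
    then show ?thesis by blast
  next
    assume h: "\<forall>x<n. \<forall>y<n. f (table_mult A F x y) = table_mult A F' (f y) (f x)"
    have "F' (pair_map True p (x, y)) = t (F (x, y))" if "x \<in> A" "y \<in> A" for x y
      using h[rule_format, OF pf(2)[OF that(1)] pf(2)[OF that(2)]] that pf Fm tf
      by (simp add: table_mult_def pair_map_def)
    then show ?thesis by blast
  qed
  then show ?thesis using FT p t by (auto simp: table_rel_def)
qed

text \<open>Relabels the carrier so that the products become \<open>{0..<m}\<close> and the zero
  becomes 0; the table is the multiplication transported to the remaining elements.\<close>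

lemma ex_table_mult_iso:
  assumes mm: "mm \<in> nil3_semigroups n" and card: "card (square_set n mm) = m"
  shows "\<exists>F\<in>full_tables A m. (mm, table_mult A F) \<in> iso_anti_rel n"
proof -
  let ?Q = "square_set n mm"
  note closed = nil3_closed[OF mm]
  have Qn: "?Q \<subseteq> {0..<n}" by (rule square_set_subset[OF mm])
  have assoc: "mm (mm x y) z = mm x (mm y z)" if "x < n" "y < n" "z < n" for x y z
    using mm that by (auto simp: nil3_semigroups_def nilpotent3_on_def is_semigroup_on_def)
  obtain z where cube: "{mm (mm x y) z | x y z. x < n \<and> y < n \<and> z < n} = {z}"
    using mm by (auto simp: nil3_semigroups_def nilpotent3_on_def card_1_singleton_iff)
  have z3: "mm (mm x y) w = z" if "x < n" "y < n" "w < n" for x y w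
    using cube that by blast
  have zQ: "z \<in> ?Q"
    using z3[of 0 0 0] m closed[of 0 0] square_setI[of "mm 0 0" n 0 mm] by simp
  have mult_Q: "mm x y = z" if "x < n" "y < n" "x \<in> ?Q \<or> y \<in> ?Q" for x y
    using that z3 assoc by (auto simp: square_set_def)
  have fin: "finite ?Q" using Qn finite_subset by blast
  obtain h0 where h0: "bij_betw h0 ?Q {0..<m}"
    using ex_bij_betw_finite_nat[OF fin] card by auto
  \<comment> \<open>The enumeration \<open>h0\<close> is arbitrary; the transposition corrects it so
    that the zero \<open>z\<close> is sent to 0.\<close>
  define h where "h = Transposition.transpose (h0 z) 0 \<circ> h0"
  have "h0 z \<in> {0..<m}" using h0 zQ by (auto simp: bij_betw_def)
  then have "Transposition.transpose (h0 z) 0 permutes {0..<m}"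
    using m by (intro permutes_swap_id) auto
  then have h: "bij_betw h ?Q {0..<m}"
    unfolding h_def by (rule bij_betw_trans[OF h0 permutes_imp_bij])
  have "h ` ?Q \<subseteq> {0..<n}" using h m by (auto simp: bij_betw_def)
  then obtain f where f: "f permutes {0..<n}" "\<forall>x\<in>?Q. f x = h x"
    using ex_permutes_extend[OF _ Qn bij_betw_imp_inj_on[OF h]] by auto
  have f0: "f z = 0" using f(2) zQ by (simp add: h_def)
  have fQ: "f ` ?Q = {0..<m}" using f(2) h by (auto simp: bij_betw_def)
  have fn: "f x < n \<longleftrightarrow> x < n" for x using permutes_in_image[OF f(1), of x] by simp
  have fA: "f x \<in> A \<longleftrightarrow> x \<in> {0..<n} - ?Q" for x
  proof -
    have "f x < m \<longleftrightarrow> x \<in> ?Q"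
      using fQ inj_image_mem_iff[OF permutes_inj[OF f(1)], of x ?Q] by simp
    then show ?thesis using fn[of x] A by auto
  qed
  define g where "g = inv_into UNIV f"
  have gf: "g (f x) = x" for x unfolding g_def by (simp add: permutes_inverses(2)[OF f(1)])
  define F where "F = (\<lambda>(x, y)\<in>A \<times> A. f (mm (g x) (g y)))"
  have prod: "f (mm x y) = table_mult A F (f x) (f y)" if "x < n" "y < n" for x y
  proof (cases "x \<in> ?Q \<or> y \<in> ?Q")
    case True
    then show ?thesis using mult_Q[OF that True] f0 fA by (auto simp: table_mult_def)
  next
    case False
    then show ?thesis using that fA[of x] fA[of y] by (simp add: table_mult_def F_def gf)
  qed
  have "F (x, y) < m" if xy: "x \<in> A" "y \<in> A" for x y
  proof -
    obtain x' y' where xy': "x = f x'" "y = f y'" using permutes_surj[OF f(1)] by (metis surjD)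
    then have "x' < n" "y' < n" using xy fA by auto
    then have "mm x' y' \<in> ?Q" by (auto simp: square_set_def)
    then have "f (mm x' y') < m" using fQ by auto
    then show ?thesis using xy xy' by (simp add: F_def gf)
  qed
  then have FT: "F \<in> tables A m" by (auto simp: tables_def F_def)
  have "c \<in> F ` (A \<times> A)" if c: "c \<in> {1..<m}" for c
  proof -
    obtain q where q: "q \<in> ?Q" "c = f q" using fQ c by (metis imageE atLeastLessThan_iff le0)
    then obtain x y where xy: "q = mm x y" "x < n" "y < n" by (auto simp: square_set_def)
    \<comment> \<open>A nonzero product has no factor that is itself a product, so \<open>c\<close>
      is attained at a pair from \<open>A\<close>.\<close>
    have "q \<noteq> z" using q f0 c by auto
    then have "x \<notin> ?Q" "y \<notin> ?Q" using mult_Q xy by auto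
    then have "f x \<in> A" "f y \<in> A" using fA xy by auto
    moreover from this have "c = F (f x, f y)" using q xy by (simp add: F_def gf)
    ultimately show ?thesis by blast
  qed
  then have F: "F \<in> full_tables A m" using FT by (auto simp: full_tables_def)
  have "iso_or_anti n mm (table_mult A F)"
    unfolding iso_or_anti_def using permutes_imp_bij[OF f(1)] prod by blast
  then show ?thesis using F mm table_mult_nil3[OF F] by (auto simp: iso_anti_rel_def)
qed

lemma ex_bij_quotient_square:
  "\<exists>h. bij_betw h (full_tables A m // table_rel A m)
    ({mm \<in> nil3_semigroups n. card (square_set n mm) = m} // iso_anti_rel n)"
proof (rule quotient_transfer[where g = "table_mult A", OF equiv_iso_anti_rel _ equiv_table_rel])
  show "table_mult A ` full_tables A m \<subseteq> {mm \<in> nil3_semigroups n. card (square_set n mm) = m}"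
    by (auto simp: table_mult_nil3 square_set_table_mult)
qed (use table_rel_imp_iso iso_imp_table_rel ex_table_mult_iso in \<open>auto simp: full_tables_def\<close>)

end

text \<open>The number of products is invariant under (anti-)isomorphism, so the classes can be
  sorted by it.\<close>

lemma num_nil3_eq_sum:
  "num_nil3 n = (\<Sum>m=2..n. card (full_tables {m..<n} m // table_rel {m..<n} m))"
proof -
  let ?R = "iso_anti_rel n"
  define X where "X = (\<lambda>m. {mm \<in> nil3_semigroups n. card (square_set n mm) = m})"
  have "card (square_set n mm) \<in> {2..n}" if "mm \<in> nil3_semigroups n" for mm
  proof -
    have "card (square_set n mm) \<le> n"
      using card_mono[OF _ square_set_subset[OF that]] by simp
    moreover have "card (square_set n mm) > 1"
      using that by (simp add: nil3_semigroups_def nilpotent3_on_def square_set_def)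
    ultimately show ?thesis by simp
  qed
  then have "nil3_semigroups n // ?R = (\<Union>m\<in>{2..n}. X m // ?R)"
    by (fastforce simp: quotient_def X_def)
  moreover have "card (\<Union>m\<in>{2..n}. X m // ?R) = (\<Sum>m=2..n. card (X m // ?R))"
  proof (rule card_UN_disjoint)
    \<comment> \<open>\<open>X m\<close> itself can be infinite, as values outside the carrier are
      arbitrary; finiteness of the set of classes is inherited from the tables.\<close>
    show "\<forall>m\<in>{2..n}. finite (X m // ?R)"
    proof
      fix m assume "m \<in> {2..n}"
      then obtain h where "bij_betw h (full_tables {m..<n} m // table_rel {m..<n} m) (X m // ?R)"
        using ex_bij_quotient_square[of m n "{m..<n}"] by (auto simp: X_def)
      moreover have "finite (full_tables {m..<n} m)"
        by (rule finite_subset[OF _ finite_tables[of "{m..<n}" m]]) (auto simp: full_tables_def)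
      then have "finite (full_tables {m..<n} m // table_rel {m..<n} m)"
        by (simp add: quotient_def)
      ultimately show "finite (X m // ?R)" using bij_betw_finite by blast
    qed
    have "R1 \<noteq> R2" if "m \<noteq> m'" and R12: "R1 \<in> X m // ?R" "R2 \<in> X m' // ?R" for m m' R1 R2
    proof
      assume eq: "R1 = R2"
      obtain a b where ab: "a \<in> X m" "R1 = ?R `` {a}" "b \<in> X m'" "R2 = ?R `` {b}"
        using R12 by (auto elim!: quotientE)
      then have "(a, b) \<in> ?R"
        using eq eq_equiv_class_iff[OF equiv_iso_anti_rel, of a n b] by (simp add: X_def)
      then show False using card_square_set_iso[of a b n] ab \<open>m \<noteq> m'\<close> by (simp add: X_def)
    qed
    then show "\<forall>i\<in>{2..n}. \<forall>j\<in>{2..n}. i \<noteq> j \<longrightarrow> X i // ?R \<inter> X j // ?R = {}" by blast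
  qed simp
  moreover have "card (X m // ?R) = card (full_tables {m..<n} m // table_rel {m..<n} m)"
    if "m \<in> {2..n}" for m
    using ex_bij_quotient_square[of m n "{m..<n}"] that
    by (auto simp: X_def dest: bij_betw_same_card)
  ultimately show ?thesis by (simp add: num_nil3_def)
qed

section \<open>The range of summation\<close>

lemma full_tables_empty_if:
  assumes "finite A" "m - 1 > card A ^ 2"
  shows "full_tables A m = {}"
proof -
  have False if F: "F \<in> full_tables A m" for F
  proof -
    have "card {1..<m} \<le> card (F ` (A \<times> A))"
      using F assms(1) by (intro card_mono) (auto simp: full_tables_def)
    also have "\<dots> \<le> card (A \<times> A)" using assms(1) by (intro card_image_le) simp
    finally show False using assms(2) by (simp add: card_cartesian_product power2_eq_square)
  qed
  then show ?thesis by blast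
qed

text \<open>With d = n - m, the condition reads n - 3/4 \<le> (d + 1/2)^2 = d^2 + d + 1/4. Since n =
  d + m, the linear term cancels and m - 1 \<le> d^2 remains; the constants 1/2 and 3/4 come from
  completing this square.\<close>

lemma le_a_bound_iff:
  assumes "1 \<le> m" "m \<le> n"
  shows "int m \<le> a_bound n \<longleftrightarrow> m - 1 \<le> (n - m) ^ 2"
proof -
  have n: "real n - 3/4 \<ge> 0" using assms by simp
  define d where "d = real n - real m"
  have d: "d \<ge> 0" "d = real (n - m)" using assms by (simp_all add: d_def)
  have "int m \<le> a_bound n \<longleftrightarrow> sqrt (real n - 3/4) \<le> d + 1/2"
    unfolding a_bound_def le_floor_iff d_def by (simp add: algebra_simps)
  also have "\<dots> \<longleftrightarrow> real n - 3/4 \<le> (d + 1/2)\<^sup>2"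
    using d n by (metis add_nonneg_nonneg half_gt_zero_iff less_eq_real_def real_sqrt_le_iff
      real_sqrt_unique zero_less_one)
  also have "\<dots> \<longleftrightarrow> real m - 1 \<le> d\<^sup>2"
    by (simp add: d_def power2_eq_square algebra_simps)
  also have "\<dots> \<longleftrightarrow> real (m - 1) \<le> real ((n - m) ^ 2)"
    using d assms by simp
  finally show ?thesis by (simp only: of_nat_le_iff)
qed

theorem theorem2p3:
  fixes n :: nat
  assumes "n \<ge> 1"
  shows "real (num_nil3 n) =
    (\<Sum>m\<in>{2..nat (a_bound n)}. Lfun n m - Lfun (n - 1) (m - 1))"
proof -
  let ?c = "\<lambda>m. card (full_tables {m..<n} m // table_rel {m..<n} m)"
  \<comment> \<open>For \<open>n \<ge> 1\<close> the root is at least 1/2, which offsets the summand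
    1/2 in \<open>a_bound\<close> and keeps the bound at most \<open>n\<close>.\<close>
  have "sqrt (real n - 3/4) \<ge> sqrt ((1/2)\<^sup>2)"
    using assms by (intro real_sqrt_le_mono) (simp add: power2_eq_square)
  then have "a_bound n \<le> int n" unfolding a_bound_def by (simp add: floor_le_iff)
  then have sub: "{2..nat (a_bound n)} \<subseteq> {2..n}" by auto
  have "?c m = 0" if "m \<in> {2..n} - {2..nat (a_bound n)}" for m
  proof -
    have "\<not> int m \<le> a_bound n" "1 \<le> m" "m \<le> n" using that by auto
    then have "m - 1 > card {m..<n} ^ 2" using le_a_bound_iff[of m n] by simp
    then show ?thesis using full_tables_empty_if[of "{m..<n}" m] by simp
  qed
  then have "num_nil3 n = (\<Sum>m\<in>{2..nat (a_bound n)}. ?c m)"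
    unfolding num_nil3_eq_sum using sub by (intro sum.mono_neutral_right) auto
  moreover have "real (?c m) = Lfun n m - Lfun (n - 1) (m - 1)" if "m \<in> {2..nat (a_bound n)}" for m
  proof -
    have "2 \<le> m" "m \<le> n" using that sub by auto
    then show ?thesis
      using card_quotient_full_tables[of "{m..<n}" "n - m" m] by simp
  qed
  ultimately show ?thesis by simp
qed

end
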